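(* Let $l,n\ge 0$ be integers, let $\lambda\in\mathbb{R}$, and let $d=2l+1-n$ be the superdimension of $\mathbb{R}^{2l+1|n}$. If $d\neq -1$, then the map $$\varphi:\mathcal{F}_\lambda(\mathbb{R}^{2l+1|n})\to \mathrm{Ber}_{\frac{2\lambda}{d+1}}(\mathbb{R}^{2l+1|n}),\qquad g\,\alpha^\lambda\mapsto g\,|Dx|^{\frac{2\lambda}{d+1}}\quad (g\in C^\infty(\mathbb{R}^{2l+1|n}))$$ is an isomorphism of $\mathcal{K}(2l+1|n)$-modules, where $\mathrm{Ber}_{\frac{2\lambda}{d+1}}(\mathbb{R}^{2l+1|n})$ is regarded as a $\mathcal{K}(2l+1|n)$-module by restriction from $\mathrm{Vect}(\mathbb{R}^{2l+1|n})$.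
   Context: Coordinates on the supermanifold $\mathbb{R}^{2l+1|n}$: even coordinates $z,x_1,\dots,x_l,y_1,\dots,y_l$ and odd coordinates $\theta_1,\dots,\theta_n$. Write $q^0=z$, $q^r=x_r$ for $1\le r\le l$, $q^r=y_{r-l}$ for $l+1\le r\le 2l$, $q^r=\theta_{r-2l}$ for $2l+1\le r\le 2l+n$. A tilde denotes parity ($\mathbb{Z}/2$-degree). Formulas with parity signs are stated for homogeneous elements and extended by linearity. $C^\infty(\mathbb{R}^{2l+1|n})$ is the superalgebra of superfunctions, and $\mathrm{Vect}(\mathbb{R}^{2l+1|n})$ is the Lie superalgebra of vector fields (superderivations). Contact structure: the standard contact form is $\alpha=dz+\sum_{i=1}^l(x_i\,dy_i-y_i\,dx_i)+\sum_{j=1}^n\theta_j\,d\theta_j=dz+\omega_{rs}q^r dq^s$, where $(\omega_{rs})_{1\le r,s\le 2l+n}$ is the block matrix $\begin{pmatrix}0&\mathrm{id}_l&0\\-\mathrm{id}_l&0&0\\0&0&\mathrm{id}_n\end{pmatrix}$, and $(\omega^{rs})$ is its inverse matrix $\begin{pmatrix}0&-\mathrm{id}_l&0\\ \mathrm{id}_l&0&0\\0&0&\mathrm{id}_n\end{pmatrix}$. Its kernel is spanned over superfunctions by $T_r=\partial_{x_r}+y_r\partial_z$ ($1\le r\le l$), $T_r=\partial_{y_{r-l}}-x_{r-l}\partial_z$ ($l+1\le r\le 2l$), $T_r=\partial_{\theta_{r-2l}}-\theta_{r-2l}\partial_z$ ($2l+1\le r\le 2l+n$). Contact vector fields: $\mathcal{K}(2l+1|n)\subset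 \mathrm{Vect}(\mathbb{R}^{2l+1|n})$ is the Lie superalgebra consisting of the fields $X_f=f\partial_z-\frac12(-1)^{\tilde f\,\tilde T_r}\omega^{rs}T_r(f)T_s$, $f\in C^\infty(\mathbb{R}^{2l+1|n})$ (repeated indices $r,s$ are summed over $1,\dots,2l+n$). Write $f'=\partial_z f$. Density modules: for $\lambda\in\mathbb{R}$, $\mathrm{Ber}_\lambda(\mathbb{R}^{2l+1|n})$ is the space $C^\infty(\mathbb{R}^{2l+1|n})$ (elements written $g|Dx|^\lambda$) with the action of $X=\sum_A X^A\partial_{q^A}\in\mathrm{Vect}(\mathbb{R}^{2l+1|n})$ given by $\mathbb{L}^\lambda_X(g)=X(g)+\lambda\,\mathrm{div}(X)\,g$, where $\mathrm{div}(X)=\sum_A(-1)^{\widetilde{X^A}\,\widetilde{q^A}}\partial_{q^A}X^A$. The space $\mathcal{F}_\lambda(\mathbb{R}^{2l+1|n})$ is $C^\infty(\mathbb{R}^{2l+1|n})$ (elements written $g\alpha^\lambda$) with the action of $X_f\in\mathcal{K}(2l+1|n)$ given by $L^\lambda_{X_f}(g)=X_f(g)+\lambda f' g$. *)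

theory Defs
  imports "HOL-Analysis.Analysis" "HOL-Library.Function_Algebras"
begin

section \<open>Superfunctions\<close>

text \<open>
  All coordinates \<open>q\<^sup>r\<close> carry one common index \<open>r \<in> {0..2l+n}\<close>; those with \<open>r \<le> 2l\<close> are even,
  those with \<open>2l < r\<close> are odd.  A superfunction is encoded by its coefficients: \<open>F I\<close> is the
  coefficient of the monomial \<open>\<theta>\<^sup>I\<close>, the product of the odd coordinates \<open>q\<^sup>i\<close>, \<open>i \<in> I\<close>, taken in
  increasing order.  A function on \<open>p\<close>-dimensional space is encoded as a function of sequences
  that depends only on the first \<open>p\<close> entries.

  The additive structure on superfunctions (and on operators on them) is the pointwise one of
  \<^theory>\<open>HOL-Library.Function_Algebras\<close>; the pointwise product and unit of that theory are
  not the product and unit of superfunctions.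
\<close>

type_synonym sfun = "nat set \<Rightarrow> (nat \<Rightarrow> real) \<Rightarrow> real"
type_synonym soperator = "sfun \<Rightarrow> sfun"

definition partial :: "nat \<Rightarrow> ((nat \<Rightarrow> real) \<Rightarrow> real) \<Rightarrow> (nat \<Rightarrow> real) \<Rightarrow> real" where
  "partial i f = (\<lambda>x. deriv (\<lambda>t. f (x(i := t))) (x i))"

text \<open>Continuity below refers to the product topology on sequences; for functions of the first
  \<open>p\<close> entries only, this is ordinary continuity on \<open>p\<close>-dimensional space.\<close>

definition smooth :: "nat \<Rightarrow> ((nat \<Rightarrow> real) \<Rightarrow> real) \<Rightarrow> bool" where
  "smooth p f \<longleftrightarrow>
     (\<forall>x y. (\<forall>i<p. x i = y i) \<longrightarrow> f x = f y) \<and>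
     (\<forall>js. set js \<subseteq> {..<p} \<longrightarrow>
        continuous_on UNIV (fold partial js f) \<and>
        (\<forall>i<p. \<forall>x. (\<lambda>t. fold partial js f (x(i := t))) differentiable (at (x i))))"

definition superfunctions :: "nat \<Rightarrow> nat \<Rightarrow> sfun set" where
  "superfunctions l n =
     {F. (\<forall>I. smooth (2 * l + 1) (F I)) \<and> (\<forall>I. \<not> I \<subseteq> {2 * l + 1..2 * l + n} \<longrightarrow> F I = 0)}"

definition sscale :: "real \<Rightarrow> sfun \<Rightarrow> sfun" (infixr "\<cdot>" 75) where
  "c \<cdot> F = (\<lambda>I x. c * F I x)"

text \<open>\<open>\<theta>\<^sup>J \<theta>\<^sup>K = shuffle_sign J K \<theta>\<^bsup>J \<union> K\<^esup>\<close> for disjoint \<open>J\<close> and \<open>K\<close>.\<close>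

definition shuffle_sign :: "nat set \<Rightarrow> nat set \<Rightarrow> real" where
  "shuffle_sign J K = (-1) ^ card {(j, k). j \<in> J \<and> k \<in> K \<and> k < j}"

definition sprod :: "sfun \<Rightarrow> sfun \<Rightarrow> sfun" (infixl "\<odot>" 70) where
  "F \<odot> G = (\<lambda>I x. \<Sum>J\<in>Pow I. shuffle_sign J (I - J) * F J x * G (I - J) x)"

text \<open>Parities are natural numbers modulo 2.\<close>

definition parity_part :: "nat \<Rightarrow> sfun \<Rightarrow> sfun" where
  "parity_part p F = (\<lambda>I. if card I mod 2 = p mod 2 then F I else 0)"

definition homogeneous :: "nat \<Rightarrow> sfun \<Rightarrow> bool" where
  "homogeneous p F \<longleftrightarrow> parity_part p F = F"

definition index_parity :: "nat \<Rightarrow> nat \<Rightarrow> nat" where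
  "index_parity l r = (if r \<le> 2 * l then 0 else 1)"

definition coordinate :: "nat \<Rightarrow> nat \<Rightarrow> sfun" where
  "coordinate l r =
     (if r \<le> 2 * l then (\<lambda>I x. if I = {} then x r else 0) else (\<lambda>I x. if I = {r} then 1 else 0))"

text \<open>Odd partial derivatives act from the left.\<close>

definition pd :: "nat \<Rightarrow> nat \<Rightarrow> soperator" where
  "pd l r F =
     (if r \<le> 2 * l then (\<lambda>I. partial r (F I))
      else (\<lambda>I x. if r \<in> I then 0 else (-1) ^ card {i \<in> I. i < r} * F (insert r I) x))"

section \<open>Vector fields\<close>

text \<open>Operators are only of interest on superfunctions; requiring them to vanish elsewhere makes
  equality of operators agree with equality on superfunctions.\<close>

definition linear_operator :: "nat \<Rightarrow> nat \<Rightarrow> soperator \<Rightarrow> bool" where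
  "linear_operator l n X \<longleftrightarrow>
     (\<forall>g. g \<notin> superfunctions l n \<longrightarrow> X g = 0) \<and>
     (\<forall>g\<in>superfunctions l n. X g \<in> superfunctions l n) \<and>
     (\<forall>g\<in>superfunctions l n. \<forall>h\<in>superfunctions l n. X (g + h) = X g + X h) \<and>
     (\<forall>c. \<forall>g\<in>superfunctions l n. X (c \<cdot> g) = c \<cdot> X g)"

definition has_parity :: "nat \<Rightarrow> nat \<Rightarrow> nat \<Rightarrow> soperator \<Rightarrow> bool" where
  "has_parity l n p X \<longleftrightarrow>
     (\<forall>q. \<forall>g\<in>superfunctions l n. homogeneous q g \<longrightarrow> homogeneous (p + q) (X g))"

definition superderivation :: "nat \<Rightarrow> nat \<Rightarrow> nat \<Rightarrow> soperator \<Rightarrow> bool" where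
  "superderivation l n p X \<longleftrightarrow>
     linear_operator l n X \<and> has_parity l n p X \<and>
     (\<forall>q. \<forall>g\<in>superfunctions l n. \<forall>h\<in>superfunctions l n. homogeneous q g \<longrightarrow>
        X (g \<odot> h) = X g \<odot> h + (-1) ^ (p * q) \<cdot> (g \<odot> X h))"

definition vector_fields :: "nat \<Rightarrow> nat \<Rightarrow> soperator set" where
  "vector_fields l n =
     {X + Y | X Y. superderivation l n 0 X \<and> superderivation l n 1 Y}"

text \<open>The bracket of operators of parities \<open>p\<close> and \<open>q\<close>.\<close>

definition superbracket :: "nat \<Rightarrow> nat \<Rightarrow> soperator \<Rightarrow> soperator \<Rightarrow> soperator" where
  "superbracket p q X Y = (\<lambda>g. X (Y g) - (-1) ^ (p * q) \<cdot> Y (X g))"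

definition lie_subsuperalgebra :: "nat \<Rightarrow> nat \<Rightarrow> soperator set \<Rightarrow> bool" where
  "lie_subsuperalgebra l n K \<longleftrightarrow>
     K \<subseteq> vector_fields l n \<and> 0 \<in> K \<and>
     (\<forall>X\<in>K. \<forall>Y\<in>K. X + Y \<in> K) \<and>
     (\<forall>c. \<forall>X\<in>K. (\<lambda>g. c \<cdot> X g) \<in> K) \<and>
     (\<forall>X\<in>K. \<exists>Y\<in>K. \<exists>Z\<in>K. has_parity l n 0 Y \<and> has_parity l n 1 Z \<and> X = Y + Z) \<and>
     (\<forall>p q. \<forall>X\<in>K. \<forall>Y\<in>K. has_parity l n p X \<and> has_parity l n q Y \<longrightarrow>
        superbracket p q X Y \<in> K)"

section \<open>Contact vector fields\<close>

text \<open>The inverse of the block matrix of the contact form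
  \<open>dz + \<Sum> (x\<^sub>i dy\<^sub>i - y\<^sub>i dx\<^sub>i) + \<Sum> \<theta>\<^sub>j d\<theta>\<^sub>j\<close>.\<close>

definition omega_inv :: "nat \<Rightarrow> nat \<Rightarrow> nat \<Rightarrow> real" where
  "omega_inv l r s =
     (if 1 \<le> r \<and> r \<le> l \<and> s = r + l then -1
      else if l < r \<and> r \<le> 2 * l \<and> r = s + l then 1
      else if 2 * l < r \<and> s = r then 1 else 0)"

definition T_field :: "nat \<Rightarrow> nat \<Rightarrow> soperator" where
  "T_field l r g =
     (if r \<le> l then pd l r g + coordinate l (r + l) \<odot> pd l 0 g
      else if r \<le> 2 * l then pd l r g - coordinate l (r - l) \<odot> pd l 0 g
      else pd l r g - coordinate l r \<odot> pd l 0 g)"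

text \<open>The sum over \<open>p\<close> is the linear extension from homogeneous \<open>f\<close> to all \<open>f\<close>.\<close>

definition contact_field :: "nat \<Rightarrow> nat \<Rightarrow> sfun \<Rightarrow> soperator" where
  "contact_field l n f = (\<lambda>g.
     if g \<in> superfunctions l n then
       \<Sum>p\<in>{0, 1}. parity_part p f \<odot> pd l 0 g -
         (1 / 2) \<cdot> (\<Sum>r\<in>{1..2 * l + n}. \<Sum>s\<in>{1..2 * l + n}.
           ((-1) ^ (p * index_parity l r) * omega_inv l r s) \<cdot>
             (T_field l r (parity_part p f) \<odot> T_field l s g))
     else 0)"

definition contact_fields :: "nat \<Rightarrow> nat \<Rightarrow> soperator set" where
  "contact_fields l n = contact_field l n ` superfunctions l n"

text \<open>The superfunction \<open>f\<close> with \<open>X = X\<^sub>f\<close>.\<close>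

definition contact_hamiltonian :: "nat \<Rightarrow> nat \<Rightarrow> soperator \<Rightarrow> sfun" where
  "contact_hamiltonian l n = the_inv_into (superfunctions l n) (contact_field l n)"

section \<open>Density modules\<close>

text \<open>The component \<open>X\<^sup>A\<close> of a vector field \<open>X\<close> is \<open>X (q\<^sup>A)\<close>; the sum over \<open>p\<close> is the linear
  extension from homogeneous components.\<close>

definition divergence :: "nat \<Rightarrow> nat \<Rightarrow> soperator \<Rightarrow> sfun" where
  "divergence l n X =
     (\<Sum>A\<in>{0..2 * l + n}. \<Sum>p\<in>{0, 1}.
        (-1) ^ (p * index_parity l A) \<cdot> pd l A (parity_part p (X (coordinate l A))))"

definition Ber_action :: "nat \<Rightarrow> nat \<Rightarrow> real \<Rightarrow> soperator \<Rightarrow> soperator" where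
  "Ber_action l n lam X g = X g + lam \<cdot> (divergence l n X \<odot> g)"

definition F_action :: "nat \<Rightarrow> nat \<Rightarrow> real \<Rightarrow> soperator \<Rightarrow> soperator" where
  "F_action l n lam X g = X g + lam \<cdot> (pd l 0 (contact_hamiltonian l n X) \<odot> g)"

text \<open>Modules over a Lie superalgebra \<open>K\<close> of vector fields, with underlying space a graded
  subspace \<open>V\<close> of the space of all coefficient families.\<close>

definition lie_supermodule ::
  "nat \<Rightarrow> nat \<Rightarrow> soperator set \<Rightarrow> sfun set \<Rightarrow> (soperator \<Rightarrow> soperator) \<Rightarrow> bool" where
  "lie_supermodule l n K V act \<longleftrightarrow>
     lie_subsuperalgebra l n K \<and>
     0 \<in> V \<and> (\<forall>u\<in>V. \<forall>v\<in>V. u + v \<in> V) \<and> (\<forall>c. \<forall>v\<in>V. c \<cdot> v \<in> V) \<and>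
     (\<forall>v\<in>V. v = parity_part 0 v + parity_part 1 v \<and> (\<forall>p. parity_part p v \<in> V)) \<and>
     (\<forall>X\<in>K. \<forall>v\<in>V. act X v \<in> V) \<and>
     (\<forall>X\<in>K. \<forall>u\<in>V. \<forall>v\<in>V. act X (u + v) = act X u + act X v) \<and>
     (\<forall>c. \<forall>X\<in>K. \<forall>v\<in>V. act X (c \<cdot> v) = c \<cdot> act X v) \<and>
     (\<forall>X\<in>K. \<forall>Y\<in>K. \<forall>v\<in>V. act (X + Y) v = act X v + act Y v) \<and>
     (\<forall>c. \<forall>X\<in>K. \<forall>v\<in>V. act (\<lambda>g. c \<cdot> X g) v = c \<cdot> act X v) \<and>
     (\<forall>p q. \<forall>X\<in>K. \<forall>v\<in>V. has_parity l n p X \<and> homogeneous q v \<longrightarrow>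
        homogeneous (p + q) (act X v)) \<and>
     (\<forall>p q. \<forall>X\<in>K. \<forall>Y\<in>K. \<forall>v\<in>V. has_parity l n p X \<and> has_parity l n q Y \<longrightarrow>
        act (superbracket p q X Y) v = act X (act Y v) - (-1) ^ (p * q) \<cdot> act Y (act X v))"

definition lie_supermodule_iso ::
  "nat \<Rightarrow> nat \<Rightarrow> soperator set \<Rightarrow> sfun set \<Rightarrow> (soperator \<Rightarrow> soperator) \<Rightarrow>
     sfun set \<Rightarrow> (soperator \<Rightarrow> soperator) \<Rightarrow> (sfun \<Rightarrow> sfun) \<Rightarrow> bool" where
  "lie_supermodule_iso l n K V actV W actW \<phi> \<longleftrightarrow>
     lie_supermodule l n K V actV \<and> lie_supermodule l n K W actW \<and>
     bij_betw \<phi> V W \<and>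
     (\<forall>u\<in>V. \<forall>v\<in>V. \<phi> (u + v) = \<phi> u + \<phi> v) \<and>
     (\<forall>c. \<forall>v\<in>V. \<phi> (c \<cdot> v) = c \<cdot> \<phi> v) \<and>
     (\<forall>p. \<forall>v\<in>V. homogeneous p v \<longrightarrow> homogeneous p (\<phi> v)) \<and>
     (\<forall>X\<in>K. \<forall>v\<in>V. \<phi> (actV X v) = actW X (\<phi> v))"

definition superdim :: "nat \<Rightarrow> nat \<Rightarrow> int" where
  "superdim l n = 2 * int l + 1 - int n"

end

theory Submission
  imports Defs
begin

text \<open>
  The identity map intertwines the two actions because
  \<open>div X\<^sub>f = f' - 1/2 \<Sum> \<plusminus> \<omega>\<^sup>r\<^sup>s T\<^sub>s T\<^sub>r f\<close> and the commutation relation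
  \<open>[T\<^sub>r, T\<^sub>s] = -2 \<omega>\<^sub>r\<^sub>s \<partial>\<^sub>z\<close> turns each even pair of indices into \<open>f'\<close> and each odd index into
  \<open>-f'/2\<close>, whence \<open>div X\<^sub>f = (1 + l - n/2) f' = (d + 1)/2 f'\<close>.  That both spaces are modules rests on
  \<open>[X\<^sub>f, X\<^sub>g] = X\<^sub>k\<close> with \<open>k = X\<^sub>f(g) - f' g\<close>, a consequence of the same relation, of the Leibniz rules and
  of supercommutativity, and on \<open>k' = X\<^sub>f(g') - (-1)\<^bsup>p q\<^esup> X\<^sub>g(f')\<close>.
\<close>

section \<open>Smooth functions\<close>

text \<open>The formula for \<open>k\<close> comes from the contact form:
  \<open>\<alpha>(X\<^sub>f) = f\<close> because the \<open>T\<^sub>r\<close> span its kernel, and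
  the Lie derivative of \<open>\<alpha>\<close> along \<open>X\<^sub>f\<close> is
  \<open>f' \<alpha>\<close>; hence
  \<open>\<alpha>([X\<^sub>f, X\<^sub>g]) = X\<^sub>f(g) - f' g\<close>. No forms appear below: the
  formula is verified by expanding both orders of composition. Two obstacles shape the development.
  The module axioms speak of operators, not of Hamiltonians: \<open>contact_hamiltonian\<close> is
  an inverse map, and parity is a property of the field. So \<open>f\<close> and its parity have to
  be recovered from \<open>X\<^sub>f\<close>, which is done by evaluating on coordinates. Moreover,
  superfunctions are coefficient families with side conditions, while the sign calculus wants an
  algebra; hence the total type of superfunctions and an abstract locale in which an involution
  pairs the indices and turns the double sums over \<open>r, s\<close> into single ones. The axioms
  on the side of \<open>Ber\<close> are not verified one by one: on contact fields both actions are
  the same function, so the axioms are transported.\<close>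

fun Ck :: "nat \<Rightarrow> ((nat \<Rightarrow> real) \<Rightarrow> real) \<Rightarrow> bool" where
  "Ck 0 f \<longleftrightarrow> continuous_on UNIV f"
| "Ck (Suc k) f \<longleftrightarrow> continuous_on UNIV f \<and>
     (\<forall>i x. (\<lambda>t. f (x(i := t))) differentiable (at (x i))) \<and> (\<forall>i. Ck k (partial i f))"

text \<open>No dimension enters: all directions are allowed, and the number of variables is treated
  separately. The recursion on the order replaces the lists of directions in \<open>smooth\<close>,
  so that closure under products is an induction.\<close>

definition smooth_all :: "((nat \<Rightarrow> real) \<Rightarrow> real) \<Rightarrow> bool" where
  "smooth_all f \<longleftrightarrow> (\<forall>k. Ck k f)"

lemma Ck_SucD: "Ck (Suc k) f \<Longrightarrow> Ck k f"
  by (induction k arbitrary: f) auto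

lemma smooth_all_continuous: "smooth_all f \<Longrightarrow> continuous_on UNIV f"
  by (metis Ck.simps(1) smooth_all_def)

lemma smooth_all_partial: "smooth_all f \<Longrightarrow> smooth_all (partial i f)"
  by (metis Ck.simps(2) smooth_all_def)

text \<open>The line through \<open>x\<close> in direction \<open>i\<close> is also the line through
  \<open>x(i := s)\<close>, so differentiability at every base point gives the derivative along the
  whole line.\<close>

lemma partial_DERIV:
  assumes "\<And>x. (\<lambda>t. f (x(i := t))) differentiable (at (x i))"
  shows "((\<lambda>t. f (x(i := t))) has_real_derivative partial i f (x(i := s))) (at s)"
proof -
  have "(\<lambda>t. f (x(i := t))) differentiable (at s)"
    using assms[of "x(i := s)"] by simp
  then show ?thesis
    by (metis (no_types, lifting) DERIV_imp_deriv ext fun_upd_same fun_upd_upd partial_def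
        real_differentiable_def)
qed

lemma smooth_all_DERIV:
  assumes "smooth_all f"
  shows "((\<lambda>t. f (x(i := t))) has_real_derivative partial i f (x(i := s))) (at s)"
  using assms by (intro partial_DERIV) (metis Ck.simps(2) smooth_all_def)

lemma partial_eqI:
  assumes "\<And>x. ((\<lambda>t. f (x(i := t))) has_real_derivative f' x) (at (x i))"
  shows "partial i f = f'"
  unfolding partial_def by (intro ext DERIV_imp_deriv assms)

lemma partial_const: "partial i (\<lambda>x. c) = (\<lambda>x. 0)"
  by (intro partial_eqI) auto

lemma partial_zero [simp]: "partial i 0 = 0"
  using partial_const[of i 0] by (simp add: zero_fun_def)

lemma Ck_const: "Ck k (\<lambda>x. c)"
  by (induction k arbitrary: c) (auto simp: partial_const)

lemma partial_proj: "partial i (\<lambda>x. x j) = (\<lambda>x. if i = j then 1 else 0)"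
  by (intro partial_eqI) auto

lemma Ck_proj: "Ck k (\<lambda>x. x j)"
proof (cases k)
  case 0
  then show ?thesis by (auto intro: continuous_on_product_coordinates)
next
  case (Suc k')
  have "(\<lambda>t. if j = i then t else x j) differentiable (at (x i))" for i and x :: "nat \<Rightarrow> real"
    by (cases "j = i") auto
  with Suc show ?thesis
    by (auto simp: partial_proj Ck_const continuous_on_product_coordinates)
qed

lemma partial_add:
  assumes "\<And>x. (\<lambda>t. f (x(i := t))) differentiable (at (x i))"
    and "\<And>x. (\<lambda>t. g (x(i := t))) differentiable (at (x i))"
  shows "partial i (\<lambda>x. f x + g x) = (\<lambda>x. partial i f x + partial i g x)"
proof (rule partial_eqI)
  fix x
  show "((\<lambda>t. f (x(i := t)) + g (x(i := t))) has_real_derivative partial i f x + partial i g x) (at (x i))"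
    using DERIV_add[OF partial_DERIV[OF assms(1), of x "x i"] partial_DERIV[OF assms(2), of x "x i"]]
    by (simp only: fun_upd_triv)
qed

lemma partial_mult:
  assumes "\<And>x. (\<lambda>t. f (x(i := t))) differentiable (at (x i))"
    and "\<And>x. (\<lambda>t. g (x(i := t))) differentiable (at (x i))"
  shows "partial i (\<lambda>x. f x * g x) = (\<lambda>x. partial i f x * g x + f x * partial i g x)"
proof (rule partial_eqI)
  fix x
  show "((\<lambda>t. f (x(i := t)) * g (x(i := t))) has_real_derivative partial i f x * g x + f x * partial i g x) (at (x i))"
    using DERIV_mult[OF partial_DERIV[OF assms(1), of x "x i"] partial_DERIV[OF assms(2), of x "x i"]]
    by (simp only: fun_upd_triv mult.commute[of "f x"])
qed

lemma Ck_add: "Ck k f \<Longrightarrow> Ck k g \<Longrightarrow> Ck k (\<lambda>x. f x + g x)"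
  by (induction k arbitrary: f g)
    (auto simp: partial_add intro: continuous_on_add differentiable_add)

lemma Ck_mult: "Ck k f \<Longrightarrow> Ck k g \<Longrightarrow> Ck k (\<lambda>x. f x * g x)"
proof (induction k arbitrary: f g)
  case 0
  then show ?case by (auto intro: continuous_on_mult)
next
  case (Suc k)
  \<comment> \<open>The product rule multiplies a derivative by an undifferentiated factor, so the
    induction hypothesis is also applied to \<open>f\<close> and \<open>g\<close> themselves, at the
    lower order.\<close>
  from Suc.prems have "Ck k f" "Ck k g" by (blast intro: Ck_SucD)+
  with Suc show ?case
    by (auto simp: partial_mult intro!: continuous_on_mult differentiable_mult Ck_add)
qed

lemma smooth_all_const [simp]: "smooth_all (\<lambda>x. c)"
  and smooth_all_proj: "smooth_all (\<lambda>x. x j)"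
  and smooth_all_add: "smooth_all f \<Longrightarrow> smooth_all g \<Longrightarrow> smooth_all (\<lambda>x. f x + g x)"
  and smooth_all_mult: "smooth_all f \<Longrightarrow> smooth_all g \<Longrightarrow> smooth_all (\<lambda>x. f x * g x)"
  by (auto simp: smooth_all_def Ck_const Ck_proj intro: Ck_add Ck_mult)

lemma smooth_all_zero [simp]: "smooth_all 0"
  unfolding zero_fun_def by simp

lemma smooth_all_sum: "(\<And>a. a \<in> A \<Longrightarrow> smooth_all (f a)) \<Longrightarrow> smooth_all (\<lambda>x. \<Sum>a\<in>A. f a x)"
  by (induction A rule: infinite_finite_induct) (auto intro: smooth_all_add)

lemma smooth_all_partial_add:
  "smooth_all f \<Longrightarrow> smooth_all g \<Longrightarrow> partial i (\<lambda>x. f x + g x) = (\<lambda>x. partial i f x + partial i g x)"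
  by (intro partial_add) (metis Ck.simps(2) smooth_all_def)+

lemma smooth_all_partial_mult:
  "smooth_all f \<Longrightarrow> smooth_all g \<Longrightarrow>
     partial i (\<lambda>x. f x * g x) = (\<lambda>x. partial i f x * g x + f x * partial i g x)"
  by (intro partial_mult) (metis Ck.simps(2) smooth_all_def)+

lemma smooth_all_partial_cmult:
  "smooth_all f \<Longrightarrow> partial i (\<lambda>x. c * f x) = (\<lambda>x. c * partial i f x)"
  by (subst smooth_all_partial_mult) (auto simp: partial_const)

lemma smooth_all_partial_sum:
  "(\<And>a. a \<in> A \<Longrightarrow> smooth_all (f a)) \<Longrightarrow>
     partial i (\<lambda>x. \<Sum>a\<in>A. f a x) = (\<lambda>x. \<Sum>a\<in>A. partial i (f a) x)"
  by (induction A rule: infinite_finite_induct)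
    (auto simp: partial_const smooth_all_partial_add smooth_all_sum)

section \<open>Functions of finitely many variables\<close>

definition depends_on :: "nat \<Rightarrow> ((nat \<Rightarrow> real) \<Rightarrow> real) \<Rightarrow> bool" where
  "depends_on p f \<longleftrightarrow> (\<forall>x y. (\<forall>i<p. x i = y i) \<longrightarrow> f x = f y)"

lemma depends_on_partial:
  assumes "depends_on p f"
  shows "depends_on p (partial i f)"
  unfolding depends_on_def
proof (intro allI impI)
  fix x y :: "nat \<Rightarrow> real"
  assume xy: "\<forall>i<p. x i = y i"
  show "partial i f x = partial i f y"
  proof (cases "i < p")
    case True
    have "(\<lambda>t. f (x(i := t))) = (\<lambda>t. f (y(i := t)))"
      using assms xy by (auto simp: depends_on_def)
    with True xy show ?thesis by (simp add: partial_def)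
  next
    case False
    have "f (z(i := t)) = f z" for z t
      using assms False unfolding depends_on_def by (metis fun_upd_other)
    then show ?thesis by (simp add: partial_def)
  qed
qed

lemma partial_unused:
  assumes "depends_on p f" "p \<le> i"
  shows "partial i f = 0"
proof -
  have "f (z(i := t)) = f z" for z t
    using assms unfolding depends_on_def by (metis fun_upd_other not_less)
  then show ?thesis by (auto simp: partial_def fun_eq_iff)
qed

text \<open>A derivative in a direction \<open>i \<ge> p\<close> vanishes, so admitting all
  directions in \<open>smooth_all\<close> imposes nothing new on a function of the first
  \<open>p\<close> entries.\<close>

lemma smooth_iff: "smooth p f \<longleftrightarrow> depends_on p f \<and> smooth_all f"
proof
  assume s: "smooth p f"
  have "Ck k f" if "smooth p f" for k f
    using that
  proof (induction k arbitrary: f)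
    case 0
    then show ?case
      unfolding smooth_def by (metis Ck.simps(1) empty_set empty_subsetI fold_simps(1))
  next
    case (Suc k)
    have dep: "depends_on p f"
      using Suc.prems by (simp add: smooth_def depends_on_def)
    have js: "continuous_on UNIV (fold partial js f)"
        "i < p \<Longrightarrow> (\<lambda>t. fold partial js f (x(i := t))) differentiable (at (x i))"
      if "set js \<subseteq> {..<p}" for js i x
      using Suc.prems that unfolding smooth_def by auto
    \<comment> \<open>\<open>fold\<close> applies the head of the list first, so the derivatives of
      \<open>partial i f\<close> along \<open>js\<close> are those of \<open>f\<close> along
      \<open>i # js\<close>.\<close>
    have "smooth p (partial i f)" if "i < p" for i
      using depends_on_partial[OF dep, of i] js(1)[of "i # _"] js(2)[of "i # _"] that
      by (simp add: smooth_def depends_on_def)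
    then have "Ck k (partial i f)" for i
      using Suc.IH[of "partial i f"] partial_unused[OF dep, of i] Ck_const[of k 0]
      by (cases "i < p") (auto simp: zero_fun_def)
    moreover have "(\<lambda>t. f (x(i := t))) differentiable (at (x i))" for x i
    proof (cases "i < p")
      case True
      with js(2)[of "[]"] show ?thesis by simp
    next
      case False
      then have "f (x(i := t)) = f x" for t
        using dep unfolding depends_on_def by (metis fun_upd_other)
      then show ?thesis by simp
    qed
    ultimately show ?case
      using js(1)[of "[]"] by simp
  qed
  with s show "depends_on p f \<and> smooth_all f"
    by (auto simp: smooth_all_def smooth_def depends_on_def)
next
  assume f: "depends_on p f \<and> smooth_all f"
  \<comment> \<open>The last entry of the list is the outermost derivative, hence the induction from
    the right.\<close>
  have "smooth_all (fold partial js f)" for js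
    using f by (induction js rule: rev_induct) (auto intro: smooth_all_partial)
  then have "Ck (Suc 0) (fold partial js f)" for js
    unfolding smooth_all_def by blast
  with f show "smooth p f"
    by (auto simp: smooth_def depends_on_def)
qed

text \<open>Both mixed partials are limits of the same second difference quotient, by the mean value
  theorem applied twice in either order.\<close>

lemma second_difference:
  fixes f :: "(nat \<Rightarrow> real) \<Rightarrow> real"
  assumes f: "smooth_all f" and ij: "i \<noteq> j" and h: "h > 0"
  shows "\<exists>s t. x i < s \<and> s < x i + h \<and> x j < t \<and> t < x j + h \<and>
     f (x(i := x i + h, j := x j + h)) - f (x(i := x i + h)) - f (x(j := x j + h)) + f x =
       h * h * partial j (partial i f) (x(i := s, j := t))"
proof -
  let ?g = "\<lambda>s. f (x(j := x j + h, i := s)) - f (x(i := s))"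
  have "\<exists>s. s > x i \<and> s < x i + h \<and> ?g (x i + h) - ?g (x i) =
      (x i + h - x i) * (partial i f (x(j := x j + h, i := s)) - partial i f (x(i := s)))"
    using h by (intro MVT2 DERIV_diff smooth_all_DERIV f) auto
  then obtain s where s: "s > x i" "s < x i + h" and
    e1: "?g (x i + h) - ?g (x i) =
      h * (partial i f (x(j := x j + h, i := s)) - partial i f (x(i := s)))"
    by auto
  let ?k = "\<lambda>t. partial i f (x(i := s, j := t))"
  have "\<exists>t. t > x j \<and> t < x j + h \<and> ?k (x j + h) - ?k (x j) =
      (x j + h - x j) * partial j (partial i f) (x(i := s, j := t))"
    using h by (intro MVT2 smooth_all_DERIV smooth_all_partial f) auto
  then obtain t where t: "t > x j" "t < x j + h" and
    e2: "?k (x j + h) - ?k (x j) = h * partial j (partial i f) (x(i := s, j := t))"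
    by auto
  have "x(i := s, j := x j) = x(i := s)" using ij by auto
  moreover have "x(j := x j + h, i := s') = x(i := s', j := x j + h)" for s' using ij by (auto simp: fun_upd_twist)
  moreover have "x(i := x i, j := x j + h) = x(j := x j + h)" by auto
  ultimately show ?thesis
    using s t e1 e2 by (intro exI[of _ s] exI[of _ t]) (simp add: algebra_simps)
qed

lemma partial_commute:
  assumes f: "smooth_all f"
  shows "partial i (partial j f) = partial j (partial i f)"
proof (cases "i = j")
  case False
  show ?thesis
  proof
    fix x
    define h where "h n = inverse (real (Suc n))" for n
    have h0: "h n > 0" for n by (simp add: h_def)
    have hl: "h \<longlonglongrightarrow> 0" unfolding h_def by (rule LIMSEQ_inverse_real_of_nat)
    \<comment> \<open>The quotient is symmetric in the two directions. Its limit is therefore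
      computed for an arbitrary ordered pair, and the two instances are compared by uniqueness of
      limits.\<close>
    have lim: "\<exists>u. (\<forall>n. u n =
        (f (x(i := x i + h n, j := x j + h n)) - f (x(i := x i + h n)) - f (x(j := x j + h n)) + f x) / (h n * h n))
        \<and> u \<longlonglongrightarrow> partial j (partial i f) x" if ij: "i \<noteq> j" for i j
    proof -
      from second_difference[OF f ij h0]
      obtain s t where st: "\<And>n. x i < s n \<and> s n < x i + h n \<and> x j < t n \<and> t n < x j + h n \<and>
        f (x(i := x i + h n, j := x j + h n)) - f (x(i := x i + h n)) - f (x(j := x j + h n)) + f x =
        h n * h n * partial j (partial i f) (x(i := s n, j := t n))"
        by metis
      have "s \<longlonglongrightarrow> x i"
        by (rule tendsto_sandwich[where f = "\<lambda>_. x i" and h = "\<lambda>n. x i + h n"])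
          (use st hl in \<open>auto intro!: tendsto_eq_intros always_eventually less_imp_le\<close>)
      moreover have "t \<longlonglongrightarrow> x j"
        by (rule tendsto_sandwich[where f = "\<lambda>_. x j" and h = "\<lambda>n. x j + h n"])
          (use st hl in \<open>auto intro!: tendsto_eq_intros always_eventually less_imp_le\<close>)
      ultimately have "((\<lambda>n. (x(i := s n, j := t n)) k) \<longlonglongrightarrow> x k)" for k
        by (cases "k = j"; cases "k = i") simp_all
      \<comment> \<open>Convergence in the product topology is convergence of each
        coordinate.\<close>
      then have "(\<lambda>n. x(i := s n, j := t n)) \<longlonglongrightarrow> x"
        unfolding limitin_canonical_iff [symmetric] euclidean_product_topology [symmetric]
          limitin_componentwise by simp
      then have "(\<lambda>n. partial j (partial i f) (x(i := s n, j := t n))) \<longlonglongrightarrow> partial j (partial i f) x"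
        by (rule continuous_on_tendsto_compose [OF smooth_all_continuous [OF smooth_all_partial [OF smooth_all_partial [OF f]]]]) auto
      then show ?thesis
        using st h0 by (intro exI[of _ "\<lambda>n. partial j (partial i f) (x(i := s n, j := t n))"])
          (simp add: less_imp_neq[THEN not_sym])
    qed
    obtain u where u: "\<And>n. u n =
        (f (x(i := x i + h n, j := x j + h n)) - f (x(i := x i + h n)) - f (x(j := x j + h n)) + f x) / (h n * h n)"
      and ul: "u \<longlonglongrightarrow> partial j (partial i f) x" using lim[OF False] by blast
    obtain v where v: "\<And>n. v n =
        (f (x(j := x j + h n, i := x i + h n)) - f (x(j := x j + h n)) - f (x(i := x i + h n)) + f x) / (h n * h n)"
      and vl: "v \<longlonglongrightarrow> partial i (partial j f) x" using lim[of j i] False by blast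
    have "u = v"
      using False by (auto simp: fun_eq_iff u v fun_upd_twist)
    with ul vl show "partial i (partial j f) x = partial j (partial i f) x"
      using LIMSEQ_unique by blast
  qed
qed simp

section \<open>The algebra of superfunctions\<close>

text \<open>With one factor per pair instead of a count of inversions, multiplicativity over
  disjoint unions becomes a rule about products.\<close>

lemma shuffle_sign_prod:
  assumes "finite J" "finite K"
  shows "shuffle_sign J K = (\<Prod>j\<in>J. \<Prod>k\<in>K. if k < j then -1 else 1)"
proof -
  have "{(j, k). j \<in> J \<and> k \<in> K \<and> k < j} = {x \<in> J \<times> K. snd x < fst x}" by auto
  then have "shuffle_sign J K = (\<Prod>x\<in>{x \<in> J \<times> K. snd x < fst x}. -1)"
    by (simp add: shuffle_sign_def)
  also have "\<dots> = (\<Prod>x\<in>J \<times> K. if snd x < fst x then -1 else 1)"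
    using assms by (intro prod.inter_filter) auto
  also have "\<dots> = (\<Prod>j\<in>J. \<Prod>k\<in>K. if k < j then -1 else 1)"
    using assms by (simp add: prod.cartesian_product case_prod_unfold)
  finally show ?thesis .
qed

lemma shuffle_sign_empty [simp]: "shuffle_sign {} K = 1" "shuffle_sign J {} = 1"
  by (simp_all add: shuffle_sign_def)

lemma shuffle_sign_Un_left:
  assumes "finite A" "finite B" "finite K" "A \<inter> B = {}"
  shows "shuffle_sign (A \<union> B) K = shuffle_sign A K * shuffle_sign B K"
  using assms by (simp add: shuffle_sign_prod prod.union_disjoint)

lemma shuffle_sign_Un_right:
  assumes "finite A" "finite B" "finite K" "A \<inter> B = {}"
  shows "shuffle_sign K (A \<union> B) = shuffle_sign K A * shuffle_sign K B"
  using assms by (simp add: shuffle_sign_prod prod.union_disjoint prod.distrib)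

lemma shuffle_sign_insert_left:
  assumes "finite A" "finite K" "r \<notin> A"
  shows "shuffle_sign (insert r A) K = shuffle_sign {r} K * shuffle_sign A K"
  using shuffle_sign_Un_left[of "{r}" A K] assms by simp

lemma shuffle_sign_insert_right:
  assumes "finite A" "finite K" "r \<notin> A"
  shows "shuffle_sign K (insert r A) = shuffle_sign K {r} * shuffle_sign K A"
  using shuffle_sign_Un_right[of "{r}" A K] assms by simp

lemma shuffle_sign_square: "shuffle_sign J K * shuffle_sign J K = 1"
  by (simp add: shuffle_sign_def flip: power_mult_distrib)

text \<open>Each pair of distinct elements is an inversion in exactly one of the two orders, so it
  contributes a single \<open>-1\<close>.\<close>

lemma shuffle_sign_swap:
  assumes "finite J" "finite K" "J \<inter> K = {}"
  shows "shuffle_sign J K * shuffle_sign K J = (-1) ^ (card J * card K)"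
proof -
  have "shuffle_sign J K * shuffle_sign K J =
      (\<Prod>j\<in>J. \<Prod>k\<in>K. if k < j then -1 else 1) * (\<Prod>j\<in>J. \<Prod>k\<in>K. if j < k then -1 else 1)"
    using assms by (simp add: shuffle_sign_prod) (rule prod.swap)
  also have "\<dots> = (\<Prod>j\<in>J. \<Prod>k\<in>K. (if k < j then -1 else 1) * (if j < k then -1 else 1))"
    by (simp add: prod.distrib)
  also have "\<dots> = (\<Prod>j\<in>J. \<Prod>k\<in>K. -1)"
    using assms by (intro prod.cong) auto
  also have "\<dots> = (-1) ^ (card J * card K)"
    by (simp add: mult.commute flip: power_mult)
  finally show ?thesis .
qed

text \<open>The sign in \<open>pd\<close> is the cost of bringing the factor with index
  \<open>r\<close> to the front of the monomial, hence itself a shuffle sign.\<close>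

lemma pd_sign: "(-1) ^ card {i \<in> I. i < r} = shuffle_sign {r} I"
proof -
  have "{(j, k). j \<in> {r} \<and> k \<in> I \<and> k < j} = Pair r ` {i \<in> I. i < r}" by auto
  then show ?thesis
    by (simp add: shuffle_sign_def card_image inj_on_def)
qed

text \<open>Supercommutativity of monomials, with the sign left inside the sum. Homogeneity of
  \<open>F\<close> and \<open>G\<close> is what later makes that sign constant.\<close>

lemma sprod_commute_aux:
  assumes "finite I"
  shows "(F \<odot> G) I x = (\<Sum>K\<in>Pow I. (-1) ^ (card (I - K) * card K) * (shuffle_sign K (I - K) * G K x * F (I - K) x))"
proof -
  have "(F \<odot> G) I x = (\<Sum>J\<in>Pow I. shuffle_sign J (I - J) * F J x * G (I - J) x)"
    by (simp add: sprod_def)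
  also have "\<dots> = (\<Sum>K\<in>Pow I. shuffle_sign (I - K) K * F (I - K) x * G K x)"
    by (rule sum.reindex_bij_witness[of _ "\<lambda>K. I - K" "\<lambda>K. I - K"]) (auto simp: double_diff)
  also have "\<dots> = (\<Sum>K\<in>Pow I. (-1) ^ (card (I - K) * card K) * (shuffle_sign K (I - K) * G K x * F (I - K) x))"
  proof (intro sum.cong refl)
    fix K assume "K \<in> Pow I"
    then have "finite K" "finite (I - K)" using assms finite_subset by auto
    then have "shuffle_sign (I - K) K * shuffle_sign K (I - K) = (-1) ^ (card (I - K) * card K)"
      by (intro shuffle_sign_swap) auto
    moreover have "shuffle_sign (I - K) K =
        shuffle_sign (I - K) K * shuffle_sign K (I - K) * shuffle_sign K (I - K)"
      using shuffle_sign_square[of K "I - K"] by (simp add: mult.assoc)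
    ultimately show "shuffle_sign (I - K) K * F (I - K) x * G K x =
      (-1) ^ (card (I - K) * card K) * (shuffle_sign K (I - K) * G K x * F (I - K) x)"
      by simp
  qed
  finally show ?thesis .
qed

lemma sprod_infinite [simp]: "infinite I \<Longrightarrow> (F \<odot> G) I = 0"
  by (auto simp: sprod_def fun_eq_iff)

text \<open>Both sides sum over the ordered partitions of \<open>I\<close> into three blocks. The
  signs agree because each is the product of the shuffle signs of the three pairs of blocks.\<close>

lemma sprod_assoc: "(F \<odot> G) \<odot> H = F \<odot> (G \<odot> H)"
proof (intro ext)
  fix I x
  show "((F \<odot> G) \<odot> H) I x = (F \<odot> (G \<odot> H)) I x"
  proof (cases "finite I")
    case True
    have fin: "finite A" if "A \<subseteq> I" for A using that True finite_subset by blast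
    have "((F \<odot> G) \<odot> H) I x = (\<Sum>A\<in>Pow I. \<Sum>J\<in>Pow A.
        shuffle_sign A (I - A) * shuffle_sign J (A - J) * F J x * G (A - J) x * H (I - A) x)"
      by (simp add: sprod_def sum_distrib_left sum_distrib_right mult.assoc)
    also have "\<dots> = (\<Sum>(A, J)\<in>Sigma (Pow I) Pow.
        shuffle_sign A (I - A) * shuffle_sign J (A - J) * F J x * G (A - J) x * H (I - A) x)"
      using True by (intro sum.Sigma) (auto intro: fin)
    also have "\<dots> = (\<Sum>(J, K)\<in>Sigma (Pow I) (\<lambda>J. Pow (I - J)).
        shuffle_sign J (I - J) * shuffle_sign K (I - J - K) * F J x * G K x * H (I - J - K) x)"
    proof (rule sum.reindex_bij_witness[of _ "\<lambda>(J, K). (J \<union> K, J)" "\<lambda>(A, J). (J, A - J)"], goal_cases)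
      case (5 p)
      obtain A J where p: "p = (A, J)" by (cases p)
      define K L where "K = A - J" and "L = I - A"
      from 5 p have A: "A = J \<union> K" and I: "I - J = K \<union> L" and L: "I - J - K = L" and K: "A - J = K"
        and d: "J \<inter> K = {}" "J \<inter> L = {}" "K \<inter> L = {}"
        and s: "J \<subseteq> I" "K \<subseteq> I" "L \<subseteq> I"
        by (auto simp: K_def L_def)
      have "shuffle_sign A L * shuffle_sign J K = shuffle_sign J (K \<union> L) * shuffle_sign K L"
        unfolding A using d s by (simp add: shuffle_sign_Un_left shuffle_sign_Un_right fin)
      then have "shuffle_sign A (I - A) * shuffle_sign J (A - J) = shuffle_sign J (I - J) * shuffle_sign K (I - J - K)"
        by (simp only: K L) (simp only: I flip: L_def)
      moreover have "I - A = I - J - K" unfolding L L_def ..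
      ultimately show ?case
        by (simp only: p prod.case K)
    qed auto
    also have "\<dots> = (\<Sum>J\<in>Pow I. \<Sum>K\<in>Pow (I - J).
        shuffle_sign J (I - J) * shuffle_sign K (I - J - K) * F J x * G K x * H (I - J - K) x)"
      using True by (intro sum.Sigma[symmetric]) auto
    also have "\<dots> = (F \<odot> (G \<odot> H)) I x"
      by (simp add: sprod_def sum_distrib_left sum_distrib_right mult_ac)
    finally show ?thesis .
  qed simp
qed

lemma sprod_one_left: "finite I \<Longrightarrow> (((\<lambda>I x. if I = {} then 1 else 0) \<odot> F) I x) = F I x"
proof -
  assume "finite I"
  then have "(\<Sum>J\<in>Pow I. shuffle_sign J (I - J) * (if J = {} then 1 else 0) * F (I - J) x)
     = (\<Sum>J\<in>{{}}. shuffle_sign J (I - J) * (if J = {} then 1 else 0) * F (I - J) x)"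
    by (intro sum.mono_neutral_right) auto
  then show ?thesis by (simp add: sprod_def)
qed

lemma sprod_one_right: "finite I \<Longrightarrow> ((F \<odot> (\<lambda>I x. if I = {} then 1 else 0)) I x) = F I x"
proof -
  assume I: "finite I"
  have "(\<Sum>J\<in>Pow I. shuffle_sign J (I - J) * F J x * (if I - J = {} then 1 else 0))
     = (\<Sum>J\<in>{I}. shuffle_sign J (I - J) * F J x * (if I - J = {} then 1 else 0))"
    using I by (intro sum.mono_neutral_right) auto
  then show ?thesis by (simp add: sprod_def)
qed

text \<open>A total type, so that Leibniz rules and commutation relations need no carrier; the spaces
  \<^term>\<open>superfunctions l n\<close> are subspaces of it.\<close>

typedef superfun = "{F :: sfun. (\<forall>I. smooth_all (F I)) \<and> (\<forall>I. infinite I \<longrightarrow> F I = 0)}"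
  morphisms coeffs Superfun
  by (rule exI[of _ 0]) auto

setup_lifting type_definition_superfun

lemma smooth_all_coeffs [simp]: "smooth_all (coeffs F I)"
  and coeffs_infinite [simp]: "infinite I \<Longrightarrow> coeffs F I = 0"
  using coeffs[of F] by auto

lemma superfun_eqI: "(\<And>I x. finite I \<Longrightarrow> coeffs F I x = coeffs G I x) \<Longrightarrow> F = G"
  by (metis coeffs_infinite coeffs_inject ext)

instantiation superfun :: real_algebra_1
begin

lift_definition zero_superfun :: superfun is 0 by simp

lift_definition one_superfun :: superfun is "\<lambda>I x. if I = {} then 1 else 0"
  by (auto simp: fun_eq_iff)

lift_definition plus_superfun :: "superfun \<Rightarrow> superfun \<Rightarrow> superfun" is "(+)"
  by (auto simp: plus_fun_def intro: smooth_all_add)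

lift_definition scaleR_superfun :: "real \<Rightarrow> superfun \<Rightarrow> superfun" is sscale
  by (auto simp: sscale_def fun_eq_iff intro: smooth_all_mult)

lift_definition uminus_superfun :: "superfun \<Rightarrow> superfun" is "\<lambda>F. (-1) \<cdot> F"
  by (auto simp: sscale_def fun_eq_iff intro: smooth_all_mult[of "\<lambda>x. -1", simplified])

definition minus_superfun :: "superfun \<Rightarrow> superfun \<Rightarrow> superfun" where
  "F - G = F + - G" for F G :: superfun

lift_definition times_superfun :: "superfun \<Rightarrow> superfun \<Rightarrow> superfun" is sprod
  by (auto simp: fun_eq_iff) (auto simp: sprod_def intro!: smooth_all_sum smooth_all_mult)

instance
proof
  fix a b c :: superfun and r s :: real
  show "a + b + c = a + (b + c)" by transfer simp
  show "a + b = b + a" by transfer simp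
  show "0 + a = a" by transfer simp
  show "- a + a = 0" by transfer (simp add: sscale_def fun_eq_iff)
  show "a - b = a + - b" by (fact minus_superfun_def)
  show "r *\<^sub>R (a + b) = r *\<^sub>R a + r *\<^sub>R b" by transfer (simp add: sscale_def fun_eq_iff algebra_simps)
  show "(r + s) *\<^sub>R a = r *\<^sub>R a + s *\<^sub>R a" by transfer (simp add: sscale_def fun_eq_iff algebra_simps)
  show "r *\<^sub>R s *\<^sub>R a = (r * s) *\<^sub>R a" by transfer (simp add: sscale_def fun_eq_iff)
  show "1 *\<^sub>R a = a" by transfer (simp add: sscale_def fun_eq_iff)
  show "a * b * c = a * (b * c)" by transfer (rule sprod_assoc)
  show "(a + b) * c = a * c + b * c"
    by transfer (simp add: sprod_def fun_eq_iff algebra_simps sum.distrib)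
  show "a * (b + c) = a * b + a * c"
    by transfer (simp add: sprod_def fun_eq_iff algebra_simps sum.distrib)
  show "r *\<^sub>R a * b = r *\<^sub>R (a * b)"
    by transfer (simp add: sprod_def sscale_def fun_eq_iff sum_distrib_left mult_ac)
  show "a * r *\<^sub>R b = r *\<^sub>R (a * b)"
    by transfer (simp add: sprod_def sscale_def fun_eq_iff sum_distrib_left mult_ac)
  show "1 * a = a"
    by (rule superfun_eqI) (transfer, simp add: sprod_one_left)
  show "a * 1 = a"
    by (rule superfun_eqI) (transfer, simp add: sprod_one_right)
  show "(0 :: superfun) \<noteq> 1"
    by transfer (auto simp: fun_eq_iff)
qed

end

lemma coeffs_minus: "coeffs (F - G) = coeffs F - coeffs G"
  unfolding minus_superfun_def by transfer (simp add: sscale_def fun_eq_iff)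

lemma coeffs_uminus: "coeffs (- F) = - coeffs F"
  by transfer (simp add: sscale_def fun_eq_iff)

lemma coeffs_sum: "coeffs (\<Sum>a\<in>A. F a) = (\<Sum>a\<in>A. coeffs (F a))"
  by (induction A rule: infinite_finite_induct) (simp_all add: zero_superfun.rep_eq plus_superfun.rep_eq)

lemma smooth_all_coordinate: "smooth_all (coordinate l r I)"
  by (cases "I = {}"; cases "I = {r}") (auto simp: coordinate_def smooth_all_proj)

lift_definition coord :: "nat \<Rightarrow> nat \<Rightarrow> superfun" is coordinate
  by (auto simp: smooth_all_coordinate) (auto simp: coordinate_def fun_eq_iff)

lemma smooth_all_pd: "\<forall>I. smooth_all (F I) \<Longrightarrow> smooth_all (pd l r F I)"
  by (cases "r \<in> I") (auto simp: pd_def intro: smooth_all_mult smooth_all_partial)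

lemma pd_infinite: "\<forall>I. infinite I \<longrightarrow> F I = 0 \<Longrightarrow> infinite I \<Longrightarrow> pd l r F I = 0"
  by (cases "r \<le> 2 * l") (simp add: pd_def, auto simp: pd_def zero_fun_def)

lift_definition der :: "nat \<Rightarrow> nat \<Rightarrow> superfun \<Rightarrow> superfun" is pd
  by (simp add: smooth_all_pd pd_infinite)

lift_definition part :: "nat \<Rightarrow> superfun \<Rightarrow> superfun" is parity_part
  by (auto simp: parity_part_def)

section \<open>Parity and supercommutativity\<close>

definition hom :: "nat \<Rightarrow> superfun \<Rightarrow> bool" where
  "hom p F \<longleftrightarrow> homogeneous p (coeffs F)"

lemma hom_iff: "hom p F \<longleftrightarrow> (\<forall>I. finite I \<longrightarrow> card I mod 2 \<noteq> p mod 2 \<longrightarrow> coeffs F I = 0)"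
proof -
  have "parity_part p G = G \<longleftrightarrow> (\<forall>I. card I mod 2 \<noteq> p mod 2 \<longrightarrow> G I = 0)" for G
    by (auto simp: parity_part_def fun_eq_iff[of _ G])
  then show ?thesis
    unfolding hom_def homogeneous_def using coeffs_infinite[of _ F] by (metis (no_types))
qed

lemma homD:
  assumes "hom p F" "card I mod 2 \<noteq> p mod 2"
  shows "coeffs F I x = 0"
  using assms by (cases "finite I") (auto simp: hom_iff)

lemma hom_part_eq: "hom p F \<longleftrightarrow> part p F = F"
  unfolding hom_def homogeneous_def by transfer simp

lemma hom_add: "hom p F \<Longrightarrow> hom p G \<Longrightarrow> hom p (F + G)"
  by (simp add: hom_iff plus_superfun.rep_eq)

lemma hom_scaleR: "hom p F \<Longrightarrow> hom p (c *\<^sub>R F)"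
  by (simp add: hom_iff scaleR_superfun.rep_eq sscale_def fun_eq_iff)

lemma hom_cong: "p mod 2 = q mod 2 \<Longrightarrow> hom p F \<longleftrightarrow> hom q F"
  by (simp add: hom_iff)

text \<open>Used to separate the even and odd parts of an equation: two parts of different parity
  that sum to zero both vanish.\<close>

lemma hom_both: "hom p F \<Longrightarrow> hom q F \<Longrightarrow> p mod 2 \<noteq> q mod 2 \<Longrightarrow> F = 0"
proof (rule superfun_eqI)
  fix I :: "nat set" and x
  assume "hom p F" "hom q F" "p mod 2 \<noteq> q mod 2"
  then have "coeffs F I x = 0"
    using homD[of p F I x] homD[of q F I x] by (cases "card I mod 2 = p mod 2") auto
  then show "coeffs F I x = coeffs 0 I x" by (simp add: zero_superfun.rep_eq)
qed

lemma part_linear: "linear (part p)"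
  by (rule linearI; transfer) (auto simp: parity_part_def sscale_def fun_eq_iff)

lemma part_sum: "part 0 F + part 1 F = F"
  by transfer (auto simp: parity_part_def fun_eq_iff)

lemma part_mod: "part (p mod 2) F = part p F"
  by transfer (simp add: parity_part_def)

lemma hom_part: "hom p (part p F)"
  by (auto simp: hom_iff part.rep_eq parity_part_def)

lemma part_hom_other: "hom p F \<Longrightarrow> p mod 2 \<noteq> q mod 2 \<Longrightarrow> part q F = 0"
proof (rule superfun_eqI)
  fix I :: "nat set" and x
  assume "hom p F" "p mod 2 \<noteq> q mod 2"
  then show "coeffs (part q F) I x = coeffs 0 I x"
    using homD[of p F I x] by (auto simp: part.rep_eq parity_part_def zero_superfun.rep_eq)
qed

lemma hom_mult:
  assumes "hom p F" "hom q G"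
  shows "hom (p + q) (F * G)"
  unfolding hom_iff
proof (intro allI impI ext)
  fix I :: "nat set" and x
  assume I: "finite I" "card I mod 2 \<noteq> (p + q) mod 2"
  have "coeffs F J x * coeffs G (I - J) x = 0" if "J \<subseteq> I" for J
  proof -
    have "card I = card J + card (I - J)"
      using that I(1) by (metis card_Diff_subset card_mono finite_subset le_add_diff_inverse)
    with I(2) have "card J mod 2 \<noteq> p mod 2 \<or> card (I - J) mod 2 \<noteq> q mod 2"
      using mod_add_cong[of "card J" 2 p "card (I - J)" q] by metis
    then show ?thesis using assms by (auto simp: homD)
  qed
  then show "coeffs (F * G) I x = 0 x"
    by (auto simp: times_superfun.rep_eq sprod_def mult.assoc intro!: sum.neutral)
qed

lemma supercommute:
  assumes "hom p F" "hom q G"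
  shows "F * G = (-1) ^ (p * q) *\<^sub>R (G * F)"
proof (rule superfun_eqI)
  fix I :: "nat set" and x
  assume I: "finite I"
  have "coeffs (F * G) I x = (\<Sum>K\<in>Pow I. (-1) ^ (card (I - K) * card K) *
      (shuffle_sign K (I - K) * coeffs G K x * coeffs F (I - K) x))"
    using I by (simp add: times_superfun.rep_eq sprod_commute_aux)
  also have "\<dots> = (\<Sum>K\<in>Pow I. (-1) ^ (p * q) *
      (shuffle_sign K (I - K) * coeffs G K x * coeffs F (I - K) x))"
  proof (intro sum.cong refl)
    fix K
    \<comment> \<open>Either both degrees have the prescribed parities, and the sign is the constant
      one, or one of the two coefficients is zero.\<close>
    show "(-1) ^ (card (I - K) * card K) * (shuffle_sign K (I - K) * coeffs G K x * coeffs F (I - K) x)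
       = (-1) ^ (p * q) * (shuffle_sign K (I - K) * coeffs G K x * coeffs F (I - K) x)"
    proof (cases "card K mod 2 = q mod 2 \<and> card (I - K) mod 2 = p mod 2")
      case True
      then have "even (card (I - K) * card K) \<longleftrightarrow> even (p * q)"
        by (simp add: even_iff_mod_2_eq_zero[of "card K"] even_iff_mod_2_eq_zero[of "card (I - K)"]
            even_iff_mod_2_eq_zero[of p] even_iff_mod_2_eq_zero[of q])
      then show ?thesis by (simp add: minus_one_power_iff)
    next
      case False
      then show ?thesis using assms by (auto simp: homD)
    qed
  qed
  also have "\<dots> = coeffs ((-1) ^ (p * q) *\<^sub>R (G * F)) I x"
    by (simp add: times_superfun.rep_eq scaleR_superfun.rep_eq sscale_def sprod_def sum_distrib_left)
  finally show "coeffs (F * G) I x = coeffs ((-1) ^ (p * q) *\<^sub>R (G * F)) I x" .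
qed

section \<open>Partial derivatives of superfunctions\<close>

lemma pd_odd: "\<not> r \<le> 2 * l \<Longrightarrow> pd l r F I x = (if r \<in> I then 0 else shuffle_sign {r} I * F (insert r I) x)"
  by (simp add: pd_def pd_sign)

lemma pd_odd_fun: "\<not> r \<le> 2 * l \<Longrightarrow> pd l r F I = (if r \<in> I then 0 else (\<lambda>x. shuffle_sign {r} I * F (insert r I) x))"
  by (auto simp: pd_odd)

lemma pd_even: "r \<le> 2 * l \<Longrightarrow> pd l r F I = partial r (F I)"
  by (simp add: pd_def)

lemma der_linear: "linear (der l r)"
proof (rule linearI)
  fix F G :: superfun and c :: real
  show "der l r (F + G) = der l r F + der l r G"
  proof (rule superfun_eqI)
    fix I x
    show "coeffs (der l r (F + G)) I x = coeffs (der l r F + der l r G) I x"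
      using fun_cong[OF smooth_all_partial_add[of "coeffs F I" "coeffs G I" r], of x]
      by (cases "r \<le> 2 * l")
        (simp_all add: der.rep_eq plus_superfun.rep_eq pd_odd pd_even plus_fun_def distrib_left)
  qed
  show "der l r (c *\<^sub>R F) = c *\<^sub>R der l r F"
    by (rule superfun_eqI, cases "r \<le> 2 * l")
      (simp_all add: der.rep_eq scaleR_superfun.rep_eq pd_odd pd_even sscale_def
        smooth_all_partial_cmult)
qed

lemma der_hom:
  assumes "hom p F"
  shows "hom (p + index_parity l r) (der l r F)"
  unfolding hom_iff
proof (intro allI impI ext)
  fix I :: "nat set" and x assume I: "finite I" "card I mod 2 \<noteq> (p + index_parity l r) mod 2"
  show "coeffs (der l r F) I x = 0 x"
  proof (cases "r \<le> 2 * l")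
    case True
    with I assms have "coeffs F I = 0" by (simp add: hom_iff index_parity_def)
    with True show ?thesis by (simp add: der.rep_eq pd_def)
  next
    case False
    show ?thesis
    proof (cases "r \<in> I")
      case True
      with False show ?thesis by (simp add: der.rep_eq pd_odd)
    next
      case r: False
      have "card (insert r I) mod 2 \<noteq> p mod 2"
        using I r False by (auto simp: index_parity_def) presburger
      with assms have "coeffs F (insert r I) x = 0" by (simp add: homD)
      with False show ?thesis by (simp add: der.rep_eq pd_odd)
    qed
  qed
qed

text \<open>The Leibniz rule without homogeneity, with the parity sign attached to each coefficient.
  For \<open>r \<notin> I\<close> the subsets of \<open>insert r I\<close> split into those that
  contain \<open>r\<close>, which give the derivative of \<open>F\<close>, and the others, which
  give that of \<open>G\<close>. For \<open>r \<in> I\<close> the left side is zero, and on the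
  right the contributions of \<open>J\<close> and \<open>insert r J\<close> cancel.\<close>

lemma sprod_pd_odd:
  assumes r: "\<not> r \<le> 2 * l" and I: "finite I"
  shows "pd l r (F \<odot> G) I x =
    (pd l r F \<odot> G) I x + ((\<lambda>J x. (-1) ^ card J * F J x) \<odot> pd l r G) I x"
proof (cases "r \<in> I")
  case False
  have fin: "finite A" if "A \<subseteq> I" for A using that I finite_subset by blast
  define t where "t J = shuffle_sign {r} I * (shuffle_sign J (insert r I - J) * F J x * G (insert r I - J) x)" for J
  have "pd l r (F \<odot> G) I x = (\<Sum>J\<in>Pow (insert r I). t J)"
    using r False by (simp add: pd_odd sprod_def t_def sum_distrib_left)
  also have "\<dots> = (\<Sum>J\<in>insert r ` Pow I. t J) + (\<Sum>J\<in>Pow I. t J)"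
    unfolding Pow_insert using False I by (subst sum.union_disjoint) auto
  also have "(\<Sum>J\<in>insert r ` Pow I. t J) = (\<Sum>J\<in>Pow I. t (insert r J))"
    using False by (subst sum.reindex) (auto simp: inj_on_def)
  also have "\<dots> = (pd l r F \<odot> G) I x"
    unfolding sprod_def
  proof (intro sum.cong refl)
    fix J assume J: "J \<in> Pow I"
    define K where "K = I - J"
    have eq: "insert r I - insert r J = K" "J \<inter> K = {}" and IK: "I - J = K" and I_eq: "I = J \<union> K" and eq': "r \<notin> J" "r \<notin> K" "finite J" "finite K"
      using J False by (auto simp: K_def fin)
    then have s: "shuffle_sign {r} I = shuffle_sign {r} J * shuffle_sign {r} K"
      unfolding I_eq by (intro shuffle_sign_Un_right) auto
    have "t (insert r J) = (shuffle_sign {r} K * shuffle_sign {r} K) * (shuffle_sign J K * shuffle_sign {r} J * F (insert r J) x * G K x)"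
      unfolding t_def s eq(1) using eq eq' by (simp add: shuffle_sign_insert_left[of J K r])
    then show "t (insert r J) = shuffle_sign J (I - J) * pd l r F J x * G (I - J) x"
      using r eq' by (simp add: shuffle_sign_square pd_odd IK)
  qed
  also have "(\<Sum>J\<in>Pow I. t J) = ((\<lambda>J x. (-1) ^ card J * F J x) \<odot> pd l r G) I x"
    unfolding sprod_def
  proof (intro sum.cong refl)
    fix J assume J: "J \<in> Pow I"
    define K where "K = I - J"
    have eq: "insert r I - J = insert r K" "J \<inter> K = {}" and IK: "I - J = K" and I_eq: "I = J \<union> K" and eq': "r \<notin> J" "r \<notin> K" "finite J" "finite K"
      using J False by (auto simp: K_def fin)
    then have s: "shuffle_sign {r} I = shuffle_sign {r} J * shuffle_sign {r} K"
      unfolding I_eq by (intro shuffle_sign_Un_right) auto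
    \<comment> \<open>This is the cost of moving an odd derivative past the monomial of
      \<open>J\<close>.\<close>
    have "shuffle_sign {r} J * shuffle_sign J {r} = (-1) ^ card J"
      using eq' shuffle_sign_swap[of "{r}" J] by simp
    moreover have "t J = (shuffle_sign {r} J * shuffle_sign J {r}) * (shuffle_sign J K * F J x * (shuffle_sign {r} K * G (insert r K) x))"
      unfolding t_def s eq(1) using eq eq' by (simp add: shuffle_sign_insert_right[of K J r])
    ultimately show "t J = shuffle_sign J (I - J) * ((-1) ^ card J * F J x) * pd l r G (I - J) x"
      using r eq' by (simp add: pd_odd IK)
  qed
  finally show ?thesis .
next
  case True
  define I' where "I' = I - {r}"
  have I': "I = insert r I'" "r \<notin> I'" "finite I'" using True I by (auto simp: I'_def)
  have fin: "finite A" if "A \<subseteq> I'" for A using that I' finite_subset by blast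
  have split: "(\<Sum>J\<in>Pow I. t J) = (\<Sum>J\<in>Pow I'. t (insert r J) + t J)" for t :: "nat set \<Rightarrow> real"
  proof -
    have "(\<Sum>J\<in>Pow I. t J) = (\<Sum>J\<in>insert r ` Pow I'. t J) + (\<Sum>J\<in>Pow I'. t J)"
      unfolding I'(1) Pow_insert using I' by (subst sum.union_disjoint) auto
    also have "(\<Sum>J\<in>insert r ` Pow I'. t J) = (\<Sum>J\<in>Pow I'. t (insert r J))"
      using I' by (subst sum.reindex) (auto simp: inj_on_def)
    finally show ?thesis by (simp add: sum.distrib)
  qed
  have "(pd l r F \<odot> G) I x + ((\<lambda>J x. (-1) ^ card J * F J x) \<odot> pd l r G) I x =
    (\<Sum>J\<in>Pow I. shuffle_sign J (I - J) * pd l r F J x * G (I - J) x +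
        shuffle_sign J (I - J) * ((-1) ^ card J * F J x) * pd l r G (I - J) x)"
    by (simp add: sprod_def sum.distrib)
  also have "\<dots> = 0"
    unfolding split
  proof (intro sum.neutral ballI)
    fix J assume J: "J \<in> Pow I'"
    define K where "K = I' - J"
    have eq: "I - insert r J = K" "I - J = insert r K" "J \<inter> K = {}" "r \<notin> J" "r \<notin> K" "finite J" "finite K"
      using J I' by (auto simp: K_def fin)
    have 1: "shuffle_sign J {r} * shuffle_sign {r} J = (-1) ^ card J"
      using eq shuffle_sign_swap[of J "{r}"] by simp
    have 2: "shuffle_sign {r} K * (y * shuffle_sign {r} K) = y" for y
      using shuffle_sign_square[of "{r}" K] by (simp add: algebra_simps)
    show "shuffle_sign (insert r J) (I - insert r J) * pd l r F (insert r J) x * G (I - insert r J) x +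
        shuffle_sign (insert r J) (I - insert r J) * ((-1) ^ card (insert r J) * F (insert r J) x) * pd l r G (I - insert r J) x +
        (shuffle_sign J (I - J) * pd l r F J x * G (I - J) x +
        shuffle_sign J (I - J) * ((-1) ^ card J * F J x) * pd l r G (I - J) x) = 0"
      using r eq by (simp add: pd_odd 1 2 shuffle_sign_insert_left[of J K r] shuffle_sign_insert_right[of K J r])
  qed
  finally show ?thesis using True r by (simp add: pd_odd)
qed

lemma der_mult:
  assumes "hom p F"
  shows "der l r (F * G) = der l r F * G + (-1) ^ (p * index_parity l r) *\<^sub>R (F * der l r G)"
proof (rule superfun_eqI)
  fix I :: "nat set" and x assume I: "finite I"
  show "coeffs (der l r (F * G)) I x = coeffs (der l r F * G + (-1) ^ (p * index_parity l r) *\<^sub>R (F * der l r G)) I x"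
  proof (cases "r \<le> 2 * l")
    case True
    have "coeffs (der l r (F * G)) I x = partial r (\<lambda>x. \<Sum>J\<in>Pow I. shuffle_sign J (I - J) * coeffs F J x * coeffs G (I - J) x) x"
      using True by (simp add: der.rep_eq pd_def times_superfun.rep_eq sprod_def)
    also have "\<dots> = (\<Sum>J\<in>Pow I. shuffle_sign J (I - J) * (partial r (coeffs F J) x * coeffs G (I - J) x + coeffs F J x * partial r (coeffs G (I - J)) x))"
      by (simp add: smooth_all_partial_sum smooth_all_mult smooth_all_partial_mult
          partial_const mult.assoc)
    also have "\<dots> = coeffs (der l r F * G + (-1) ^ (p * index_parity l r) *\<^sub>R (F * der l r G)) I x"
      using True by (simp add: index_parity_def der.rep_eq pd_def times_superfun.rep_eq sprod_def
          plus_superfun.rep_eq algebra_simps sum.distrib)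
    finally show ?thesis .
  next
    case False
    \<comment> \<open>Only coefficients of degree congruent to \<open>p\<close> survive, so the sign
      that depends on the degree becomes constant.\<close>
    have sgn: "(-1) ^ card J * coeffs F J y = (-1) ^ p * coeffs F J y" for J y
      using assms homD[of p F J y] by (cases "card J mod 2 = p mod 2")
        (auto simp: minus_one_power_iff even_iff_mod_2_eq_zero)
    have "((\<lambda>J y. (-1) ^ card J * coeffs F J y) \<odot> pd l r (coeffs G)) I x =
        (-1) ^ p * (coeffs F \<odot> pd l r (coeffs G)) I x"
      unfolding sgn by (simp add: sprod_def sum_distrib_left mult_ac)
    with False I show ?thesis
      by (simp add: der.rep_eq times_superfun.rep_eq plus_superfun.rep_eq scaleR_superfun.rep_eq
          sscale_def index_parity_def sprod_pd_odd)
  qed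
qed

text \<open>Two even directions commute by symmetry of mixed partials; an even and an odd one
  because the odd derivative only shifts coefficients and changes signs; two distinct odd ones
  anticommute because exchanging two generators costs a sign. For equal odd directions both sides
  are zero.\<close>

lemma der_commute:
  "der l r (der l s F) = (-1) ^ (index_parity l r * index_parity l s) *\<^sub>R der l s (der l r F)"
proof (rule superfun_eqI)
  fix I :: "nat set" and x assume I: "finite I"
  have swap: "shuffle_sign {a} {b} = - shuffle_sign {b} {a}" if "a \<noteq> b" for a b
  proof -
    have "shuffle_sign {a} {b} = shuffle_sign {a} {b} * shuffle_sign {b} {a} * shuffle_sign {b} {a}"
      using shuffle_sign_square[of "{b}" "{a}"] by (simp add: mult.assoc)
    then show ?thesis
      using that shuffle_sign_swap[of "{a}" "{b}"] by simp
  qed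
  show "coeffs (der l r (der l s F)) I x =
     coeffs ((-1) ^ (index_parity l r * index_parity l s) *\<^sub>R der l s (der l r F)) I x"
    using I
    by (cases "r \<le> 2 * l"; cases "s \<le> 2 * l"; cases "r = s"; cases "r \<in> I"; cases "s \<in> I")
      (simp_all add: der.rep_eq scaleR_superfun.rep_eq sscale_def index_parity_def pd_odd_fun
         shuffle_sign_insert_right[of I "{r}" s] shuffle_sign_insert_right[of I "{s}" r] swap[of r s] insert_commute pd_even coeffs_uminus smooth_all_partial_cmult
         partial_const partial_commute)
qed

lemma der_coord: "der l r (coord l s) = (if r = s then 1 else 0)"
proof (rule superfun_eqI)
  fix I :: "nat set" and x
  have even: "partial r (coordinate l s I) x = (if r = s \<and> I = {} then 1 else 0)" if "r \<le> 2 * l"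
    using that by (cases "s \<le> 2 * l"; cases "I = {}"; cases "I = {s}")
      (auto simp: coordinate_def partial_proj partial_const)
  have odd: "shuffle_sign {r} I * coordinate l s (insert r I) x = (if r = s \<and> I = {} then 1 else 0)"
    if "\<not> r \<le> 2 * l" "r \<notin> I"
    using that by (auto simp: coordinate_def)
  show "coeffs (der l r (coord l s)) I x = coeffs (if r = s then 1 else 0) I x"
  proof (cases "r \<le> 2 * l")
    case True
    with even show ?thesis
      by (simp add: der.rep_eq coord.rep_eq one_superfun.rep_eq zero_superfun.rep_eq pd_def)
  next
    case False
    with odd show ?thesis
      by (auto simp: der.rep_eq coord.rep_eq one_superfun.rep_eq zero_superfun.rep_eq pd_odd)
  qed
qed

lemma coord_hom: "hom (index_parity l r) (coord l r)"
  unfolding hom_iff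
proof (intro allI impI ext)
  fix I :: "nat set" and x assume "card I mod 2 \<noteq> index_parity l r mod 2"
  then show "coeffs (coord l r) I x = 0 x"
    by (cases "I = {}"; cases "I = {r}") (auto simp: coord.rep_eq coordinate_def index_parity_def)
qed

section \<open>Contact superalgebras\<close>

text \<open>All that the bracket computations use about superspace. Each row \<open>r\<close> of the
  inverse matrix has one nonzero entry, in column \<open>star r\<close> and equal to
  \<open>\<sigma> r\<close>. In the relation for \<open>T r\<close> and \<open>T s\<close> the
  factor is \<open>\<sigma> s\<close> because the entry of the original matrix at
  \<open>(r, star r)\<close> is \<open>\<sigma> (star r)\<close>. The rule
  \<open>\<sigma>_star\<close> says that this matrix is antisymmetric on even and symmetric on odd
  indices.\<close>

locale contact_superalgebra =
  fixes hom :: "nat \<Rightarrow> 'a::real_algebra \<Rightarrow> bool"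
    and d :: "'a \<Rightarrow> 'a" and T :: "'i \<Rightarrow> 'a \<Rightarrow> 'a"
    and R :: "'i set" and e :: "'i \<Rightarrow> nat" and star :: "'i \<Rightarrow> 'i" and \<sigma> :: "'i \<Rightarrow> real"
  assumes hom_mult: "hom p a \<Longrightarrow> hom q b \<Longrightarrow> hom (p + q) (a * b)"
    and hom_add: "hom p a \<Longrightarrow> hom p b \<Longrightarrow> hom p (a + b)"
    and hom_scaleR: "hom p a \<Longrightarrow> hom p (c *\<^sub>R a)"
    and hom_cong: "p mod 2 = q mod 2 \<Longrightarrow> hom p a \<longleftrightarrow> hom q a"
    and supercommute: "hom p a \<Longrightarrow> hom q b \<Longrightarrow> a * b = (-1) ^ (p * q) *\<^sub>R (b * a)"
    and d_linear: "linear d" and T_linear: "linear (T r)"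
    and hom_d: "hom p a \<Longrightarrow> hom p (d a)"
    and hom_T: "r \<in> R \<Longrightarrow> hom p a \<Longrightarrow> hom (p + e r) (T r a)"
    and d_mult: "d (a * b) = d a * b + a * d b"
    and T_mult: "r \<in> R \<Longrightarrow> hom p a \<Longrightarrow> T r (a * b) = T r a * b + (-1) ^ (p * e r) *\<^sub>R (a * T r b)"
    and d_T: "r \<in> R \<Longrightarrow> d (T r a) = T r (d a)"
    and T_T: "r \<in> R \<Longrightarrow> s \<in> R \<Longrightarrow> T r (T s a) =
      (-1) ^ (e r * e s) *\<^sub>R T s (T r a) + (if s = star r then (- 2 * \<sigma> s) *\<^sub>R d a else 0)"
    and finite_R: "finite R"
    and star_in: "r \<in> R \<Longrightarrow> star r \<in> R" and star_star: "r \<in> R \<Longrightarrow> star (star r) = r"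
    and e_star: "r \<in> R \<Longrightarrow> e (star r) = e r"
    and \<sigma>_star: "r \<in> R \<Longrightarrow> \<sigma> (star r) = - ((-1) ^ e r) * \<sigma> r"
    and \<sigma>_square: "r \<in> R \<Longrightarrow> \<sigma> r * \<sigma> r = 1"
begin

text \<open>The parity of \<open>f\<close> is a separate argument, so that the expression is linear
  in \<open>f\<close> for a fixed \<open>p\<close>.\<close>

definition X :: "nat \<Rightarrow> 'a \<Rightarrow> 'a \<Rightarrow> 'a" where
  "X p f g = f * d g - (1 / 2) *\<^sub>R (\<Sum>r\<in>R. ((-1) ^ (p * e r) * \<sigma> r) *\<^sub>R (T r f * T (star r) g))"

text \<open>The contact (Lagrange) bracket of two Hamiltonians.\<close>

definition bracket :: "nat \<Rightarrow> 'a \<Rightarrow> 'a \<Rightarrow> 'a" where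
  "bracket p f g = X p f g - d f * g"

lemma sum_star: "(\<Sum>r\<in>R. t (star r)) = (\<Sum>r\<in>R. t r)"
  by (rule sum.reindex_bij_witness[of _ star star]) (auto simp: star_in star_star)

lemmas linear_simps =
  linear_add[OF d_linear] linear_diff[OF d_linear] linear_sum[OF d_linear] linear_scale[OF d_linear]
  linear_add[OF T_linear] linear_diff[OF T_linear] linear_sum[OF T_linear] linear_scale[OF T_linear]

lemma X_linear: "linear (X p f)"
  by (rule linearI) (simp_all add: X_def linear_simps algebra_simps sum.distrib scaleR_sum_right)

lemma X_linear_left: "linear (\<lambda>f. X p f g)"
  by (rule linearI) (simp_all add: X_def linear_simps algebra_simps sum.distrib scaleR_sum_right)


lemma hom_minus: "hom p a \<Longrightarrow> hom p b \<Longrightarrow> hom p (a - b)"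
  using hom_add[of p a "(-1) *\<^sub>R b"] hom_scaleR[of p b "-1"] by simp

lemma hom_sum: "hom p 0 \<Longrightarrow> (\<And>a. a \<in> A \<Longrightarrow> hom p (t a)) \<Longrightarrow> hom p (\<Sum>a\<in>A. t a)"
  by (induction A rule: infinite_finite_induct) (auto intro: hom_add)

lemma hom_X:
  assumes "hom p f" "hom q g"
  shows "hom (p + q) (X p f g)"
proof -
  have "hom (p + q) (T r f * T (star r) g)" if "r \<in> R" for r
  proof -
    have "hom ((p + e r) + (q + e r)) (T r f * T (star r) g)"
      using assms that hom_T[of r p f] hom_T[of "star r" q g] by (auto intro!: hom_mult simp: star_in e_star)
    moreover have "((p + e r) + (q + e r)) mod 2 = (p + q) mod 2" by presburger
    ultimately show ?thesis using hom_cong by blast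
  qed
  moreover have fg: "hom (p + q) (f * d g)" by (intro hom_mult hom_d assms)
  \<comment> \<open>The locale does not postulate that zero is homogeneous; this comes from scaling
    a homogeneous element by 0.\<close>
  moreover from hom_scaleR[OF fg, of 0] have "hom (p + q) 0" by simp
  ultimately show ?thesis
    unfolding X_def by (intro hom_minus hom_scaleR hom_sum) auto
qed

lemma hom_bracket: "hom p f \<Longrightarrow> hom q g \<Longrightarrow> hom (p + q) (bracket p f g)"
  unfolding bracket_def by (intro hom_minus hom_X hom_mult hom_d)

text \<open>Moving \<open>g\<close> past \<open>T r f\<close> costs the exponent
  \<open>(p + e r) * q\<close>, and the Leibniz rule of \<open>T (star r)\<close> costs
  \<open>q * e r\<close>. The contributions of \<open>e r\<close> cancel, so every summand carries
  the sign with exponent \<open>p * q\<close>.\<close>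

lemma X_mult:
  assumes f: "hom p f" and g: "hom q g"
  shows "X p f (g * h) = X p f g * h + (-1) ^ (p * q) *\<^sub>R (g * X p f h)"
proof -
  have 1: "f * (g * d h) = (-1) ^ (p * q) *\<^sub>R (g * (f * d h))"
    using supercommute[OF f g] by (simp flip: mult.assoc)
  have 2: "((-1) ^ (p * e r) * \<sigma> r) *\<^sub>R (T r f * T (star r) (g * h)) =
     ((-1) ^ (p * e r) * \<sigma> r) *\<^sub>R (T r f * T (star r) g) * h +
     (-1) ^ (p * q) *\<^sub>R (g * ((-1) ^ (p * e r) * \<sigma> r) *\<^sub>R (T r f * T (star r) h))" if r: "r \<in> R" for r
  proof -
    have c: "T r f * g = (-1) ^ ((p + e r) * q) *\<^sub>R (g * T r f)"
      by (intro supercommute hom_T r f g)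
    have "T r f * T (star r) (g * h) = T r f * T (star r) g * h + (-1) ^ (q * e r) *\<^sub>R (T r f * g * T (star r) h)"
      using T_mult[OF star_in[OF r] g] r by (simp add: e_star algebra_simps)
    also have "\<dots> = T r f * T (star r) g * h + (-1) ^ (p * q) *\<^sub>R (g * (T r f * T (star r) h))"
      unfolding c by (cases "even p"; cases "even q"; cases "even (e r)") (simp_all add: mult.assoc)
    finally show ?thesis by (simp add: algebra_simps)
  qed
  have 3: "(\<Sum>r\<in>R. ((-1) ^ (p * e r) * \<sigma> r) *\<^sub>R (T r f * T (star r) (g * h))) =
     (\<Sum>r\<in>R. ((-1) ^ (p * e r) * \<sigma> r) *\<^sub>R (T r f * T (star r) g)) * h +
     (-1) ^ (p * q) *\<^sub>R (g * (\<Sum>r\<in>R. ((-1) ^ (p * e r) * \<sigma> r) *\<^sub>R (T r f * T (star r) h)))"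
    unfolding sum_distrib_left sum_distrib_right scaleR_sum_right sum.distrib[symmetric]
    by (intro sum.cong refl 2)
  show ?thesis
    unfolding X_def 3 by (simp add: d_mult 1 algebra_simps)
qed

text \<open>\<open>d\<close> is an even derivation commuting with every \<open>T r\<close>, and the
  remaining coefficients of \<open>X\<close> are constants, so \<open>d\<close> acts on the two
  arguments in turn.\<close>

lemma d_X: "d (X p f h) = X p (d f) h + X p f (d h)"
proof -
  have "d (T r f * T (star r) h) = T r (d f) * T (star r) h + T r f * T (star r) (d h)" if "r \<in> R" for r
    using that by (simp add: d_mult d_T star_in)
  then show ?thesis
    by (simp add: X_def linear_simps d_mult sum.distrib algebra_simps)
qed

text \<open>Contact fields preserve the contact distribution: modulo terms in the \<open>T\<^sub>r\<close>, they
  supercommute with \<open>T\<^sub>t\<close>.\<close>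

lemma T_X:
  assumes f: "hom p f" and t: "t \<in> R"
  shows "T t (X p f h) = (-1) ^ (p * e t) *\<^sub>R X p f (T t h) -
    (1 / 2) *\<^sub>R (\<Sum>r\<in>R. ((-1) ^ (p * e r) * \<sigma> r) *\<^sub>R (T t (T r f) * T (star r) h))"
proof -
  have 1: "T t (T r f * T (star r) h) = T t (T r f) * T (star r) h +
     (-1) ^ (p * e t) *\<^sub>R (T r f * T (star r) (T t h)) +
     (if r = t then ((-1) ^ ((p + e t) * e t) * (- 2 * \<sigma> (star t))) *\<^sub>R (T t f * d h) else 0)"
    if r: "r \<in> R" for r
  proof -
    have eq: "star r = star t \<longleftrightarrow> r = t" using r t by (metis star_star)
    have "T t (T (star r) h) = (-1) ^ (e t * e r) *\<^sub>R T (star r) (T t h) +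
      (if r = t then (- 2 * \<sigma> (star t)) *\<^sub>R d h else 0)"
      using T_T[OF t star_in[OF r], of h] r eq by (auto simp: e_star)
    then show ?thesis
      unfolding T_mult[OF t hom_T[OF r f]]
      by (cases "r = t"; cases "even p"; cases "even (e r)"; cases "even (e t)")
        (simp_all add: distrib_left distrib_right right_diff_distrib)
  qed
  have "T t (X p f h) = T t f * d h + (-1) ^ (p * e t) *\<^sub>R (f * d (T t h)) -
    (1 / 2) *\<^sub>R (\<Sum>r\<in>R. ((-1) ^ (p * e r) * \<sigma> r) *\<^sub>R T t (T r f * T (star r) h))"
    using T_mult[OF t f] by (simp add: X_def linear_simps d_T t)
  also have "(\<Sum>r\<in>R. ((-1) ^ (p * e r) * \<sigma> r) *\<^sub>R T t (T r f * T (star r) h)) =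
    (\<Sum>r\<in>R. ((-1) ^ (p * e r) * \<sigma> r) *\<^sub>R (T t (T r f) * T (star r) h)) +
    (-1) ^ (p * e t) *\<^sub>R (\<Sum>r\<in>R. ((-1) ^ (p * e r) * \<sigma> r) *\<^sub>R (T r f * T (star r) (T t h))) +
    (\<Sum>r\<in>R. (if r = t then ((-1) ^ (p * e t) * \<sigma> t * (-1) ^ ((p + e t) * e t) * (- 2 * \<sigma> (star t))) *\<^sub>R (T t f * d h) else 0))"
    unfolding scaleR_sum_right sum.distrib[symmetric]
    by (intro sum.cong refl) (simp add: 1 algebra_simps)
  \<comment> \<open>This diagonal term comes from the commutation relation. After multiplication by
    \<open>1/2\<close> it cancels exactly the \<open>T t f * d h\<close> produced by the Leibniz
    rule, so no multiple of \<open>d h\<close> remains.\<close>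
  also have "(\<Sum>r\<in>R. (if r = t then ((-1) ^ (p * e t) * \<sigma> t * (-1) ^ ((p + e t) * e t) * (- 2 * \<sigma> (star t))) *\<^sub>R (T t f * d h) else 0))
    = 2 *\<^sub>R (T t f * d h)"
  proof -
    have "(-1) ^ (p * e t) * \<sigma> t * (-1) ^ ((p + e t) * e t) * (- 2 * \<sigma> (star t)) = 2 * (\<sigma> t * \<sigma> t)"
      by (cases "even p"; cases "even (e t)") (simp_all add: \<sigma>_star t)
    then show ?thesis using t finite_R by (simp add: \<sigma>_square)
  qed
  finally show ?thesis
    by (simp add: X_def algebra_simps)
qed

text \<open>In the difference of the two orders, \<open>S2\<close> and the terms with
  \<open>X p f (d h)\<close> cancel, while \<open>S1\<close> and \<open>S4\<close> match the
  expansion of the right side. What remains is a relation between \<open>S3\<close>,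
  \<open>S5\<close> and \<open>S6\<close>, whose terms contain two \<open>T\<close>-derivatives of
  \<open>f\<close> or the derivative \<open>d f\<close>; it is the place where the commutation
  relation is applied to \<open>f\<close>.\<close>

theorem X_commutator:
  assumes f: "hom p f" and g: "hom q g"
  shows "X p f (X q g h) - (-1) ^ (p * q) *\<^sub>R X q g (X p f h) = X (p + q) (bracket p f g) h"
proof -
  define S1 where "S1 = (\<Sum>s\<in>R. ((-1) ^ (q * e s) * \<sigma> s) *\<^sub>R (X p f (T s g) * T (star s) h))"
  define S2 where "S2 = (\<Sum>s\<in>R. ((-1) ^ (q * e s) * \<sigma> s * (-1) ^ (p * (q + e s))) *\<^sub>R (T s g * X p f (T (star s) h)))"
  define S3 where "S3 = (\<Sum>s\<in>R. \<Sum>r\<in>R. ((-1) ^ (q * e s + p * e r) * \<sigma> s * \<sigma> r) *\<^sub>R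
     (T s g * (T (star s) (T r f) * T (star r) h)))"
  define S4 where "S4 = (\<Sum>s\<in>R. ((-1) ^ ((p + q) * e s) * \<sigma> s) *\<^sub>R (T s (d f) * g * T (star s) h))"
  define S5 where "S5 = (\<Sum>s\<in>R. ((-1) ^ (q * e s) * \<sigma> s) *\<^sub>R (d f * T s g * T (star s) h))"
  define S6 where "S6 = (\<Sum>s\<in>R. \<Sum>r\<in>R. ((-1) ^ ((p + q) * e s + p * e r) * \<sigma> s * \<sigma> r) *\<^sub>R
     (T s (T r f) * T (star r) g * T (star s) h))"
  have XfXg: "X p f (X q g h) = X p f g * d h + (-1) ^ (p * q) *\<^sub>R (g * X p f (d h)) - (1/2) *\<^sub>R (S1 + S2)"
  proof -
    have "X p f (T s g * T (star s) h) = X p f (T s g) * T (star s) h + (-1) ^ (p * (q + e s)) *\<^sub>R (T s g * X p f (T (star s) h))"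
      if "s \<in> R" for s using that by (intro X_mult f hom_T g)
    moreover have "X p f (X q g h) = X p f (g * d h) - (1/2) *\<^sub>R (\<Sum>s\<in>R. ((-1) ^ (q * e s) * \<sigma> s) *\<^sub>R X p f (T s g * T (star s) h))"
      unfolding X_def[of q g h]
      by (simp only: linear_diff[OF X_linear] linear_scale[OF X_linear] linear_sum[OF X_linear])
    ultimately show ?thesis
      by (simp add: X_mult[OF f g] S1_def S2_def algebra_simps flip: sum.distrib)
  qed
  have XgXf: "(-1) ^ (p * q) *\<^sub>R X q g (X p f h) = (-1) ^ (p * q) *\<^sub>R (g * X p (d f) h) +
     (-1) ^ (p * q) *\<^sub>R (g * X p f (d h)) - (1/2) *\<^sub>R S2 + (1/4) *\<^sub>R ((-1) ^ (p * q) *\<^sub>R S3)"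
  proof -
    have "((-1) ^ (q * e s) * \<sigma> s) *\<^sub>R (T s g * T (star s) (X p f h)) =
       (-1) ^ (p * q) *\<^sub>R (((-1) ^ (q * e s) * \<sigma> s * (-1) ^ (p * (q + e s))) *\<^sub>R (T s g * X p f (T (star s) h))) -
       (1/2) *\<^sub>R (\<Sum>r\<in>R. ((-1) ^ (q * e s + p * e r) * \<sigma> s * \<sigma> r) *\<^sub>R
         (T s g * (T (star s) (T r f) * T (star r) h)))" if s: "s \<in> R" for s
    proof -
      have sg: "(-1::real) ^ (p * q) * ((-1) ^ (q * e s) * \<sigma> s * (-1) ^ (p * (q + e s))) = (-1) ^ (q * e s) * \<sigma> s * (-1) ^ (p * e s)"
        by (cases "even p"; cases "even q"; cases "even (e s)") simp_all
      show ?thesis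
        unfolding T_X[OF f star_in[OF s]] scaleR_scaleR sg
        by (simp add: e_star s algebra_simps sum_distrib_left scaleR_sum_right power_add)
    qed
    then have sum_eq: "(\<Sum>s\<in>R. ((-1) ^ (q * e s) * \<sigma> s) *\<^sub>R (T s g * T (star s) (X p f h))) =
       (-1) ^ (p * q) *\<^sub>R S2 - (1/2) *\<^sub>R S3"
      by (simp add: S2_def S3_def sum_subtractf scaleR_sum_right)
    show ?thesis
      unfolding X_def[of q g "X p f h"] sum_eq d_X by (simp add: algebra_simps)
  qed
  have gX: "(-1) ^ (p * q) *\<^sub>R (g * X p (d f) h) = d f * g * d h - (1/2) *\<^sub>R S4"
  proof -
    have 1: "(-1) ^ (p * q) *\<^sub>R (g * (d f * d h)) = d f * g * d h"
      using supercommute[OF hom_d[OF f] g] by (simp flip: mult.assoc)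
    have "(-1) ^ (p * q) *\<^sub>R (g * (((-1) ^ (p * e r) * \<sigma> r) *\<^sub>R (T r (d f) * T (star r) h))) =
      ((-1) ^ ((p + q) * e r) * \<sigma> r) *\<^sub>R (T r (d f) * g * T (star r) h)" if r: "r \<in> R" for r
      unfolding supercommute[OF hom_T[OF r hom_d[OF f]] g]
      by (cases "even p"; cases "even q"; cases "even (e r)") (simp_all add: mult.assoc)
    then have 2: "(-1) ^ (p * q) *\<^sub>R (g * (\<Sum>r\<in>R. ((-1) ^ (p * e r) * \<sigma> r) *\<^sub>R (T r (d f) * T (star r) h))) = S4"
      unfolding S4_def sum_distrib_left scaleR_sum_right by (intro sum.cong refl)
    have "(-1) ^ (p * q) *\<^sub>R (g * X p (d f) h) = (-1) ^ (p * q) *\<^sub>R (g * (d f * d h)) -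
      (1/2) *\<^sub>R ((-1) ^ (p * q) *\<^sub>R (g * (\<Sum>r\<in>R. ((-1) ^ (p * e r) * \<sigma> r) *\<^sub>R (T r (d f) * T (star r) h))))"
      unfolding X_def by (simp add: algebra_simps)
    then show ?thesis unfolding 1 2 .
  qed
  have XB: "X (p + q) (bracket p f g) h = X p f g * d h - d f * g * d h -
      (1/2) *\<^sub>R S1 + (1/4) *\<^sub>R S6 + (1/2) *\<^sub>R S4 + (1/2) *\<^sub>R S5"
  proof -
    have "((-1) ^ ((p + q) * e s) * \<sigma> s) *\<^sub>R (T s (bracket p f g) * T (star s) h) =
      ((-1) ^ (q * e s) * \<sigma> s) *\<^sub>R (X p f (T s g) * T (star s) h) -
      (1/2) *\<^sub>R (\<Sum>r\<in>R. ((-1) ^ ((p + q) * e s + p * e r) * \<sigma> s * \<sigma> r) *\<^sub>R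
        (T s (T r f) * T (star r) g * T (star s) h)) -
      ((-1) ^ ((p + q) * e s) * \<sigma> s) *\<^sub>R (T s (d f) * g * T (star s) h) -
      ((-1) ^ (q * e s) * \<sigma> s) *\<^sub>R (d f * T s g * T (star s) h)" if s: "s \<in> R" for s
    proof -
      have sg: "(-1::real) ^ (q * e s) = (-1) ^ ((p + q) * e s) * (-1) ^ (p * e s)"
        by (cases "even p"; cases "even q"; cases "even (e s)") simp_all
      have TB: "T s (bracket p f g) = (-1) ^ (p * e s) *\<^sub>R X p f (T s g) -
          (1 / 2) *\<^sub>R (\<Sum>r\<in>R. ((-1) ^ (p * e r) * \<sigma> r) *\<^sub>R (T s (T r f) * T (star r) g)) -
          T s (d f) * g - (-1) ^ (p * e s) *\<^sub>R (d f * T s g)"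
        unfolding bracket_def
        by (simp add: linear_simps T_X[OF f s] T_mult[OF s hom_d[OF f]])
      show ?thesis
        unfolding sg TB
        by (simp add: algebra_simps sum_distrib_right scaleR_sum_right power_add)
    qed
    then have sum_eq: "(\<Sum>s\<in>R. ((-1) ^ ((p + q) * e s) * \<sigma> s) *\<^sub>R (T s (bracket p f g) * T (star s) h)) =
       S1 - (1/2) *\<^sub>R S6 - S4 - S5"
      by (simp add: S1_def S4_def S5_def S6_def sum_subtractf scaleR_sum_right)
    show ?thesis
      unfolding X_def[of "p + q"] sum_eq by (simp add: bracket_def algebra_simps)
  qed
  \<comment> \<open>Exchanging \<open>T (star s)\<close> and \<open>T r\<close> on \<open>f\<close>
    turns a summand of \<open>S3\<close> into one of \<open>S6\<close>. The diagonal correction of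
    the commutation relation is proportional to \<open>d f\<close> and accounts for
    \<open>S5\<close>.\<close>
  have S36: "(-1) ^ (p * q) *\<^sub>R S3 = - S6 - 2 *\<^sub>R S5"
  proof -
    have term_eq: "((-1) ^ (p * q) * ((-1) ^ (q * e s + p * e r) * \<sigma> s * \<sigma> r)) *\<^sub>R
         (T s g * (T (star s) (T r f) * T (star r) h)) =
       - (((-1) ^ ((p + q) * e r + p * e s) * \<sigma> r * \<sigma> (star s)) *\<^sub>R (T r (T (star s) f) * T s g * T (star r) h)) -
       (if s = r then (2 * ((-1) ^ (q * e r) * \<sigma> r)) *\<^sub>R (d f * T r g * T (star r) h) else 0)"
      if s: "s \<in> R" and r: "r \<in> R" for s r
    proof -
      have eq: "star s = star r \<longleftrightarrow> s = r" using r s by (metis star_star)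
      have TT: "T r (T (star s) f) = (-1) ^ (e r * e s) *\<^sub>R T (star s) (T r f) +
        (if s = r then (- 2 * \<sigma> (star r)) *\<^sub>R d f else 0)"
        using T_T[OF r star_in[OF s], of f] s eq by (auto simp: e_star)
      have "T s g * T (star s) (T r f) = (-1) ^ ((q + e s) * (p + e r + e s)) *\<^sub>R (T (star s) (T r f) * T s g)"
        using hom_T[OF s g] hom_T[OF star_in[OF s] hom_T[OF r f]] s by (intro supercommute) (auto simp: e_star)
      then have c: "T s g * (T (star s) (T r f) * T (star r) h) =
         (-1) ^ ((q + e s) * (p + e r + e s)) *\<^sub>R (T (star s) (T r f) * T s g * T (star r) h)"
        by (simp flip: mult.assoc)
      have q: "\<sigma> r * (\<sigma> r * u) = u" for u using \<sigma>_square[OF r] by (simp flip: mult.assoc)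
      show ?thesis
        unfolding TT c
        by (cases "s = r"; cases "even p"; cases "even q"; cases "even (e r)"; cases "even (e s)")
          (simp_all add: \<sigma>_star s r algebra_simps q)
    qed
    have "(-1) ^ (p * q) *\<^sub>R S3 = (\<Sum>s\<in>R. \<Sum>r\<in>R. ((-1) ^ (p * q) * ((-1) ^ (q * e s + p * e r) * \<sigma> s * \<sigma> r)) *\<^sub>R
         (T s g * (T (star s) (T r f) * T (star r) h)))"
      by (simp add: S3_def scaleR_sum_right)
    also have "\<dots> = (\<Sum>s\<in>R. \<Sum>r\<in>R. - (((-1) ^ ((p + q) * e r + p * e s) * \<sigma> r * \<sigma> (star s)) *\<^sub>R (T r (T (star s) f) * T s g * T (star r) h)) -
       (if s = r then (2 * ((-1) ^ (q * e r) * \<sigma> r)) *\<^sub>R (d f * T r g * T (star r) h) else 0))"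
      by (intro sum.cong refl term_eq)
    also have "\<dots> = - (\<Sum>s\<in>R. \<Sum>r\<in>R. (((-1) ^ ((p + q) * e r + p * e s) * \<sigma> r * \<sigma> (star s)) *\<^sub>R (T r (T (star s) f) * T s g * T (star r) h))) -
       (\<Sum>s\<in>R. (2 * ((-1) ^ (q * e s) * \<sigma> s)) *\<^sub>R (d f * T s g * T (star s) h))"
      using finite_R by (simp add: sum_subtractf sum_negf)
    also have "(\<Sum>s\<in>R. (2 * ((-1) ^ (q * e s) * \<sigma> s)) *\<^sub>R (d f * T s g * T (star s) h)) = 2 *\<^sub>R S5"
      by (simp add: S5_def scaleR_sum_right)
    also have "(\<Sum>s\<in>R. \<Sum>r\<in>R. (((-1) ^ ((p + q) * e r + p * e s) * \<sigma> r * \<sigma> (star s)) *\<^sub>R (T r (T (star s) f) * T s g * T (star r) h))) =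
       (\<Sum>r\<in>R. \<Sum>s\<in>R. (((-1) ^ ((p + q) * e r + p * e s) * \<sigma> r * \<sigma> (star s)) *\<^sub>R (T r (T (star s) f) * T s g * T (star r) h)))"
      by (rule sum.swap)
    \<comment> \<open>Replacing \<open>s\<close> by \<open>star s\<close> moves \<open>star\<close>
      from the derivative of \<open>f\<close> to that of \<open>g\<close>, as in
      \<open>S6\<close>.\<close>
    also have "\<dots> = (\<Sum>r\<in>R. \<Sum>s\<in>R. (((-1) ^ ((p + q) * e r + p * e (star s)) * \<sigma> r * \<sigma> (star (star s))) *\<^sub>R (T r (T (star (star s)) f) * T (star s) g * T (star r) h)))"
      by (intro sum.cong refl sum_star[symmetric])
    also have "\<dots> = S6"
      unfolding S6_def by (intro sum.cong refl) (simp add: star_star e_star)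
    finally show ?thesis .
  qed
  show ?thesis
    unfolding XfXg XgXf gX XB S36 by (simp add: algebra_simps)
qed

text \<open>In the expanded bracket the terms \<open>f * d g\<close> and \<open>- (d f * g)\<close>
  are exchanged, and the sum is mapped to itself by reindexing with \<open>star\<close>. The sign of
  \<open>\<sigma>_star\<close> absorbs the part of the commutation sign that comes from
  \<open>e r\<close>.\<close>

lemma bracket_skew:
  assumes f: "hom p f" and g: "hom q g"
  shows "bracket p f g = - ((-1) ^ (p * q) *\<^sub>R bracket q g f)"
proof -
  have 1: "(-1) ^ (p * q) *\<^sub>R (g * d f) = d f * g" "(-1) ^ (p * q) *\<^sub>R (d g * f) = f * d g"
    using supercommute[OF hom_d[OF f] g] supercommute[OF f hom_d[OF g]] by simp_all
  have "((-1) ^ (p * e r) * \<sigma> r) *\<^sub>R (T r f * T (star r) g) =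
      - ((-1) ^ (p * q) *\<^sub>R (((-1) ^ (q * e (star r)) * \<sigma> (star r)) *\<^sub>R (T (star r) g * T (star (star r)) f)))"
    if r: "r \<in> R" for r
  proof -
    have "T r f * T (star r) g = (-1) ^ ((p + e r) * (q + e r)) *\<^sub>R (T (star r) g * T r f)"
      using hom_T[OF r f] hom_T[OF star_in[OF r] g] r by (intro supercommute) (simp_all add: e_star)
    then show ?thesis
      using r by (cases "even p"; cases "even q"; cases "even (e r)")
        (simp_all add: \<sigma>_star e_star star_star)
  qed
  then have "(\<Sum>r\<in>R. ((-1) ^ (p * e r) * \<sigma> r) *\<^sub>R (T r f * T (star r) g)) =
     - ((-1) ^ (p * q) *\<^sub>R (\<Sum>r\<in>R. ((-1) ^ (q * e (star r)) * \<sigma> (star r)) *\<^sub>R (T (star r) g * T (star (star r)) f)))"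
    by (simp add: scaleR_sum_right sum_negf)
  also have "\<dots> = - ((-1) ^ (p * q) *\<^sub>R (\<Sum>r\<in>R. ((-1) ^ (q * e r) * \<sigma> r) *\<^sub>R (T r g * T (star r) f)))"
    by (simp only: sum_star[of "\<lambda>r. ((-1) ^ (q * e r) * \<sigma> r) *\<^sub>R (T r g * T (star r) f)"])
  finally show ?thesis
    unfolding bracket_def X_def using 1 by (simp add: algebra_simps)
qed

text \<open>Reindexing by \<open>star\<close> and reordering the two derivatives gives the negative
  of the same sum, so only the corrections from the commutation relation survive. Each contributes
  \<open>2 * (-1) ^ e r\<close>, and solving for the sum removes the 2.\<close>

lemma sum_T_T: "(\<Sum>r\<in>R. \<sigma> r *\<^sub>R T r (T (star r) f)) = (\<Sum>r\<in>R. (-1) ^ e r) *\<^sub>R d f"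
proof -
  define S where "S = (\<Sum>r\<in>R. \<sigma> r *\<^sub>R T r (T (star r) f))"
  have "\<sigma> r *\<^sub>R T r (T (star r) f) =
      - (\<sigma> (star r) *\<^sub>R T (star r) (T (star (star r)) f)) + (2 * (-1) ^ e r) *\<^sub>R d f" if r: "r \<in> R" for r
    unfolding T_T[OF r star_in[OF r]]
    using r \<sigma>_square[OF r] by (cases "even (e r)") (simp_all add: \<sigma>_star e_star star_star algebra_simps)
  then have "S = (\<Sum>r\<in>R. - (\<sigma> (star r) *\<^sub>R T (star r) (T (star (star r)) f)) + (2 * (-1) ^ e r) *\<^sub>R d f)"
    unfolding S_def by (intro sum.cong refl)
  also have "\<dots> = - S + (2 * (\<Sum>r\<in>R. (-1) ^ e r)) *\<^sub>R d f"
    using sum_star[of "\<lambda>r. \<sigma> r *\<^sub>R T r (T (star r) f)"]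
    by (simp add: S_def sum.distrib sum_subtractf sum_negf sum_distrib_left scaleR_sum_left)
  finally have "2 *\<^sub>R S = 2 *\<^sub>R ((\<Sum>r\<in>R. (-1) ^ e r) *\<^sub>R d f)"
    by (metis add.commute diff_add_cancel scaleR_2 scaleR_scaleR uminus_add_conv_diff)
  then show ?thesis unfolding S_def by (metis scaleR_cancel_left zero_neq_numeral)
qed

text \<open>By \<open>d_X\<close> the derivative contains \<open>X p (d f) g - d (d f) * g\<close>,
  the bracket of \<open>d f\<close> with \<open>g\<close>. Skew symmetry trades it for
  \<open>X q g (d f)\<close>, and the product \<open>d g * d f\<close> arising there cancels
  \<open>d f * d g\<close>.\<close>

lemma d_bracket:
  assumes f: "hom p f" and g: "hom q g"
  shows "d (bracket p f g) = X p f (d g) - (-1) ^ (p * q) *\<^sub>R X q g (d f)"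
proof -
  have "X p (d f) g - d (d f) * g = - ((-1) ^ (p * q) *\<^sub>R (X q g (d f) - d g * d f))"
    using bracket_skew[OF hom_d[OF f] g] by (simp add: bracket_def)
  moreover have "(-1) ^ (p * q) *\<^sub>R (d g * d f) = d f * d g"
    using supercommute[OF hom_d[OF f] hom_d[OF g]] by simp
  ultimately show ?thesis
    by (simp add: bracket_def linear_simps d_X d_mult algebra_simps)
qed

section \<open>The density action for an arbitrary weight\<close>

definition density :: "real \<Rightarrow> nat \<Rightarrow> 'a \<Rightarrow> 'a \<Rightarrow> 'a" where
  "density c p f v = X p f v + c *\<^sub>R (d f * v)"

text \<open>The terms \<open>d g * X p f v\<close> and \<open>d f * X q g v\<close> cancel between
  the two orders, the quadratic term in \<open>c\<close> cancels by supercommutativity, and the rest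
  is \<open>c\<close> times \<open>d_bracket\<close>.\<close>

lemma density_commutator:
  assumes f: "hom p f" and g: "hom q g"
  shows "density c p f (density c q g v) - (-1) ^ (p * q) *\<^sub>R density c q g (density c p f v) =
    density c (p + q) (bracket p f g) v"
proof -
  have comm: "d f * (d g * v) = (-1) ^ (p * q) *\<^sub>R (d g * (d f * v))"
    using supercommute[OF hom_d[OF f] hom_d[OF g]] by (simp flip: mult.assoc)
  have fg: "X p f (d g * v) = X p f (d g) * v + (-1) ^ (p * q) *\<^sub>R (d g * X p f v)"
    by (intro X_mult f hom_d g)
  have gf: "d f * X q g v = (-1) ^ (p * q) *\<^sub>R X q g (d f * v) - (-1) ^ (p * q) *\<^sub>R (X q g (d f) * v)"
    using X_mult[OF g hom_d[OF f], of v] by (simp add: mult.commute[of q p] algebra_simps)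
  show ?thesis
    unfolding density_def d_bracket[OF f g] X_commutator[OF f g, symmetric]
      linear_add[OF X_linear] linear_scale[OF X_linear]
    by (simp add: fg algebra_simps comm gf)
qed

end

section \<open>Contact vector fields on superspace\<close>

definition star :: "nat \<Rightarrow> nat \<Rightarrow> nat" where
  "star l r = (if r \<le> l then r + l else if r \<le> 2 * l then r - l else r)"

text \<open>The nonzero entry in row \<open>r\<close> of the inverse matrix of the contact form, which is in column
  \<open>star l r\<close>.\<close>

definition omega :: "nat \<Rightarrow> nat \<Rightarrow> real" where
  "omega l r = (if r \<le> l then -1 else 1)"

text \<open>The coefficient of \<open>\<partial>\<^sub>z\<close> in the field
  \<open>T\<^sub>r\<close>, in one formula for its three blocks: \<open>y\<close>, \<open>-x\<close>
  and \<open>-\<theta>\<close>.\<close>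

definition contact_coeff :: "nat \<Rightarrow> nat \<Rightarrow> superfun" where
  "contact_coeff l r = (- omega l r) *\<^sub>R coord l (star l r)"

definition contact_T :: "nat \<Rightarrow> nat \<Rightarrow> superfun \<Rightarrow> superfun" where
  "contact_T l r g = der l r g + contact_coeff l r * der l 0 g"

definition contact_indices :: "nat \<Rightarrow> nat \<Rightarrow> nat set" where
  "contact_indices l n = {1..2 * l + n}"

lemma omega_inv_eq:
  "1 \<le> r \<Longrightarrow> 1 \<le> s \<Longrightarrow> omega_inv l r s = (if s = star l r then omega l r else 0)"
  by (auto simp: omega_inv_def star_def omega_def)

lemma star_ge_1: "1 \<le> r \<Longrightarrow> 1 \<le> star l r"
  and star_in_indices: "r \<in> contact_indices l n \<Longrightarrow> star l r \<in> contact_indices l n"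
  and star_star: "1 \<le> r \<Longrightarrow> star l (star l r) = r"
  and parity_star: "1 \<le> r \<Longrightarrow> index_parity l (star l r) = index_parity l r"
  and omega_star: "1 \<le> r \<Longrightarrow> omega l (star l r) = - ((-1) ^ index_parity l r) * omega l r"
  and omega_square: "omega l r * omega l r = 1"
  by (auto simp: star_def omega_def index_parity_def contact_indices_def)

lemma hom_contact_coeff: "1 \<le> r \<Longrightarrow> hom (index_parity l r) (contact_coeff l r)"
  unfolding contact_coeff_def by (metis coord_hom hom_scaleR parity_star)

lemmas der_simps =
  linear_add[OF der_linear] linear_diff[OF der_linear] linear_sum[OF der_linear]
  linear_scale[OF der_linear] linear_0[OF der_linear]

lemma der_contact_coeff:
  "der l A (contact_coeff l r) = (if A = star l r then (- omega l r) *\<^sub>R 1 else 0)"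
  unfolding contact_coeff_def der_simps by (simp add: der_coord)

lemma der_0_contact_coeff: "1 \<le> r \<Longrightarrow> der l 0 (contact_coeff l r) = 0"
  using star_ge_1[of r l] by (simp add: der_contact_coeff)

text \<open>The direction \<open>z\<close> is even, so no sign depends on the parity of
  \<open>F\<close>, and the Leibniz rule extends from the two parity parts to all of
  \<open>F\<close>.\<close>

lemma der_0_mult: "der l 0 (F * G) = der l 0 F * G + F * der l 0 G"
proof -
  have "der l 0 (part p F * G) = der l 0 (part p F) * G + part p F * der l 0 G" for p
    using der_mult[OF hom_part, of l 0 p F G] by (simp add: index_parity_def)
  from this[of 0] this[of 1] have
    "der l 0 ((part 0 F + part 1 F) * G) = der l 0 (part 0 F + part 1 F) * G + (part 0 F + part 1 F) * der l 0 G"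
    by (simp add: der_simps algebra_simps)
  then show ?thesis unfolding part_sum .
qed

lemma der_0_commute: "der l 0 (der l r F) = der l r (der l 0 F)"
  using der_commute[of l 0 r F] by (simp add: index_parity_def)

lemma hom_der_0: "hom p F \<Longrightarrow> hom p (der l 0 F)"
  using der_hom[of p F l 0] by (simp add: index_parity_def)

lemma contact_T_linear: "linear (contact_T l r)"
  by (rule linearI) (simp_all add: contact_T_def der_simps algebra_simps)

lemma contact_T_hom:
  assumes "1 \<le> r" "hom p F"
  shows "hom (p + index_parity l r) (contact_T l r F)"
proof -
  have "hom (index_parity l r + p) (contact_coeff l r * der l 0 F)"
    by (intro hom_mult hom_contact_coeff hom_der_0 assms)
  then show ?thesis
    unfolding contact_T_def using assms by (auto intro!: hom_add der_hom simp: add.commute)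
qed

lemma contact_T_mult:
  assumes "1 \<le> r" "hom p F"
  shows "contact_T l r (F * G) = contact_T l r F * G + (-1) ^ (p * index_parity l r) *\<^sub>R (F * contact_T l r G)"
proof -
  have "contact_coeff l r * (F * der l 0 G) = (-1) ^ (p * index_parity l r) *\<^sub>R (F * (contact_coeff l r * der l 0 G))"
    using supercommute[OF hom_contact_coeff[OF assms(1)] assms(2), of l] by (simp add: mult.commute flip: mult.assoc)
  then show ?thesis
    unfolding contact_T_def der_mult[OF assms(2), of l r] der_0_mult by (simp add: algebra_simps)
qed

lemma der_0_contact_T: "1 \<le> r \<Longrightarrow> der l 0 (contact_T l r F) = contact_T l r (der l 0 F)"
  unfolding contact_T_def der_simps der_0_mult der_0_commute[of l r] by (simp add: der_0_contact_coeff)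

text \<open>Second-order terms match by supercommutativity of the derivatives and of the
  coefficients. Only the derivatives of the coefficients differ, and they multiply
  \<open>der l 0 F\<close>.\<close>

lemma contact_T_contact_T:
  assumes r: "1 \<le> r" and s: "1 \<le> s"
  shows "contact_T l r (contact_T l s F) =
     (-1) ^ (index_parity l r * index_parity l s) *\<^sub>R contact_T l s (contact_T l r F) +
     (if s = star l r then (- 2 * omega l s) *\<^sub>R der l 0 F else 0)"
proof -
  define k where "k = index_parity l r * index_parity l s"
  define c where "c = contact_coeff l"
  have expand: "contact_T l r (contact_T l s F) = der l r (der l s F) + der l r (c s) * der l 0 F +
      (-1) ^ k *\<^sub>R (c s * der l r (der l 0 F)) + c r * der l s (der l 0 F) + c r * (c s * der l 0 (der l 0 F))"
    if "1 \<le> r" "1 \<le> s" "k = index_parity l r * index_parity l s" for r s k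
    unfolding contact_T_def der_simps der_mult[OF hom_contact_coeff[OF that(2)], of l r] der_0_mult der_0_commute[of l s]
    using that by (simp add: der_0_contact_coeff c_def algebra_simps)
  have cc: "(-1) ^ k *\<^sub>R (c s * (c r * G)) = c r * (c s * G)" for G
    using supercommute[OF hom_contact_coeff[OF r] hom_contact_coeff[OF s], of l l]
    by (simp add: k_def c_def flip: mult.assoc)
  \<comment> \<open>Both coefficient derivatives are nonzero exactly when
    \<open>s = star l r\<close>, since \<open>star\<close> is an involution. They give
    \<open>- omega l s\<close> and, after the sign, \<open>omega l s\<close>; the difference is the
    constant \<open>- 2 * omega l s\<close>.\<close>
  have 1: "der l r (c s) = (if s = star l r then - omega l s else 0) *\<^sub>R 1"
    using star_star[OF r] star_star[OF s] by (auto simp: c_def der_contact_coeff)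
  have 2: "(-1) ^ k *\<^sub>R der l s (c r) = (if s = star l r then omega l s else 0) *\<^sub>R 1"
    using omega_star[OF r] parity_star[OF r]
    by (cases "even (index_parity l r)") (auto simp: c_def der_contact_coeff k_def)
  have e1: "contact_T l r (contact_T l s F) = der l r (der l s F) + der l r (c s) * der l 0 F +
      (-1) ^ k *\<^sub>R (c s * der l r (der l 0 F)) + c r * der l s (der l 0 F) + c r * (c s * der l 0 (der l 0 F))"
    by (rule expand[OF r s k_def])
  have "contact_T l s (contact_T l r F) = der l s (der l r F) + der l s (c r) * der l 0 F +
      (-1) ^ k *\<^sub>R (c r * der l s (der l 0 F)) + c s * der l r (der l 0 F) + c s * (c r * der l 0 (der l 0 F))"
    by (rule expand[OF s r]) (simp add: k_def)
  then have "(-1) ^ k *\<^sub>R contact_T l s (contact_T l r F) = (-1) ^ k *\<^sub>R der l s (der l r F) +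
      ((-1) ^ k *\<^sub>R der l s (c r)) * der l 0 F + c r * der l s (der l 0 F) +
      (-1) ^ k *\<^sub>R (c s * der l r (der l 0 F)) + (-1) ^ k *\<^sub>R (c s * (c r * der l 0 (der l 0 F)))"
    by (simp add: scaleR_add_right)
  then have e2: "(-1) ^ k *\<^sub>R contact_T l s (contact_T l r F) = der l r (der l s F) +
      ((-1) ^ k *\<^sub>R der l s (c r)) * der l 0 F + c r * der l s (der l 0 F) +
      (-1) ^ k *\<^sub>R (c s * der l r (der l 0 F)) + c r * (c s * der l 0 (der l 0 F))"
    unfolding cc using der_commute[of l r s F] by (simp add: k_def)
  have "(-1) ^ k *\<^sub>R contact_T l s (contact_T l r F) + (if s = star l r then (- 2 * omega l s) *\<^sub>R der l 0 F else 0) =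
     contact_T l r (contact_T l s F)"
    unfolding e1 e2 1 2
    using scaleR_add_left[of "omega l s" "omega l s" "der l 0 F"] by (cases "s = star l r") simp_all
  then show ?thesis by (simp add: k_def)
qed

lemma T_field_eq: "1 \<le> r \<Longrightarrow> T_field l r (coeffs g) = coeffs (contact_T l r g)"
  by (simp add: T_field_def contact_T_def contact_coeff_def omega_def star_def coeffs_minus coeffs_uminus
      plus_superfun.rep_eq times_superfun.rep_eq der.rep_eq coord.rep_eq)

lemma contact_T_coord: "1 \<le> r \<Longrightarrow> 1 \<le> A \<Longrightarrow> contact_T l r (coord l A) = (if r = A then 1 else 0)"
  by (simp add: contact_T_def der_coord)

lemma contact_T_coord_0: "1 \<le> r \<Longrightarrow> contact_T l r (coord l 0) = contact_coeff l r"
  by (simp add: contact_T_def der_coord)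

section \<open>The space of superfunctions inside the total type\<close>

definition in_superfunctions :: "nat \<Rightarrow> nat \<Rightarrow> superfun \<Rightarrow> bool" where
  "in_superfunctions l n f \<longleftrightarrow> coeffs f \<in> superfunctions l n"

lemma in_superfunctions_iff: "in_superfunctions l n f \<longleftrightarrow>
    (\<forall>I. depends_on (2 * l + 1) (coeffs f I)) \<and> (\<forall>I. \<not> I \<subseteq> {2 * l + 1..2 * l + n} \<longrightarrow> coeffs f I = 0)"
  by (auto simp: in_superfunctions_def superfunctions_def smooth_iff)

lemma superfunctionsE:
  assumes "F \<in> superfunctions l n"
  obtains f where "F = coeffs f" "in_superfunctions l n f"
proof -
  have "F I = 0" if "infinite I" for I
    using assms that finite_subset[of I "{2 * l + 1..2 * l + n}"] by (auto simp: superfunctions_def)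
  then have "coeffs (Superfun F) = F"
    using assms by (intro Superfun_inverse) (auto simp: superfunctions_def smooth_iff)
  with assms that show thesis by (metis in_superfunctions_def)
qed

lemma in_superfunctions_zero [simp]: "in_superfunctions l n 0"
  by (auto simp: in_superfunctions_iff zero_superfun.rep_eq depends_on_def)

lemma in_superfunctions_add:
  "in_superfunctions l n f \<Longrightarrow> in_superfunctions l n g \<Longrightarrow> in_superfunctions l n (f + g)"
  unfolding in_superfunctions_iff plus_superfun.rep_eq
  by (auto simp: depends_on_def plus_fun_def) metis

lemma in_superfunctions_scaleR: "in_superfunctions l n f \<Longrightarrow> in_superfunctions l n (c *\<^sub>R f)"
  unfolding in_superfunctions_iff scaleR_superfun.rep_eq sscale_def
  by (auto simp: depends_on_def fun_eq_iff)

lemma in_superfunctions_diff: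
  "in_superfunctions l n f \<Longrightarrow> in_superfunctions l n g \<Longrightarrow> in_superfunctions l n (f - g)"
  using in_superfunctions_add[of l n f "(-1) *\<^sub>R g"] in_superfunctions_scaleR[of l n g "-1"] by simp

lemma in_superfunctions_sum:
  "(\<And>a. a \<in> A \<Longrightarrow> in_superfunctions l n (f a)) \<Longrightarrow> in_superfunctions l n (\<Sum>a\<in>A. f a)"
  by (induction A rule: infinite_finite_induct) (auto intro: in_superfunctions_add)

lemma in_superfunctions_mult:
  assumes "in_superfunctions l n f" "in_superfunctions l n g"
  shows "in_superfunctions l n (f * g)"
  unfolding in_superfunctions_iff
proof (intro conjI allI impI)
  fix I
  have "coeffs f J x = coeffs f J y" "coeffs g J x = coeffs g J y" if "\<forall>i<2 * l + 1. x i = y i" for J x y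
    using assms that unfolding in_superfunctions_iff depends_on_def by blast+
  then show "depends_on (2 * l + 1) (coeffs (f * g) I)"
    unfolding depends_on_def times_superfun.rep_eq sprod_def
    by (intro allI impI sum.cong refl arg_cong2[where f = "(*)"]) blast+
  assume I: "\<not> I \<subseteq> {2 * l + 1..2 * l + n}"
  have "coeffs f J x * coeffs g (I - J) x = 0" if "J \<subseteq> I" for J x
  proof (cases "J \<subseteq> {2 * l + 1..2 * l + n}")
    case True
    with I have "\<not> I - J \<subseteq> {2 * l + 1..2 * l + n}" by blast
    with assms(2) show ?thesis by (simp add: in_superfunctions_iff)
  next
    case False
    with assms(1) show ?thesis by (simp add: in_superfunctions_iff)
  qed
  then show "coeffs (f * g) I = 0"
    by (auto simp: times_superfun.rep_eq sprod_def mult.assoc fun_eq_iff intro!: sum.neutral)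
qed

lemma in_superfunctions_der:
  assumes "in_superfunctions l n f"
  shows "in_superfunctions l n (der l r f)"
  unfolding in_superfunctions_iff
proof (intro conjI allI impI)
  fix I
  show "depends_on (2 * l + 1) (coeffs (der l r f) I)"
  proof (cases "r \<le> 2 * l")
    case True
    with assms show ?thesis
      by (simp add: der.rep_eq pd_even in_superfunctions_iff depends_on_partial)
  next
    case False
    have "depends_on (2 * l + 1) (coeffs f (insert r I))"
      using assms by (simp add: in_superfunctions_iff)
    with False show ?thesis
      by (simp add: der.rep_eq pd_odd_fun depends_on_def)
  qed
  assume I: "\<not> I \<subseteq> {2 * l + 1..2 * l + n}"
  then have "\<not> insert r I \<subseteq> {2 * l + 1..2 * l + n}" by blast
  with I assms have "coeffs f I = 0" "coeffs f (insert r I) = 0"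
    unfolding in_superfunctions_iff by blast+
  then show "coeffs (der l r f) I = 0"
    by (cases "r \<le> 2 * l") (simp_all add: der.rep_eq pd_even pd_odd_fun zero_fun_def partial_const)
qed

lemma in_superfunctions_coord:
  assumes "r \<le> 2 * l + n"
  shows "in_superfunctions l n (coord l r)"
  using assms by (auto simp: in_superfunctions_iff coord.rep_eq coordinate_def depends_on_def fun_eq_iff)

lemma in_superfunctions_part: "in_superfunctions l n f \<Longrightarrow> in_superfunctions l n (part p f)"
  by (auto simp: in_superfunctions_iff part.rep_eq parity_part_def depends_on_def)

lemma in_superfunctions_contact_T:
  "r \<in> contact_indices l n \<Longrightarrow> in_superfunctions l n f \<Longrightarrow> in_superfunctions l n (contact_T l r f)"
  unfolding contact_T_def contact_coeff_def using star_in_indices[of r l n]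
  by (auto simp: contact_indices_def intro!: in_superfunctions_add in_superfunctions_mult in_superfunctions_scaleR
      in_superfunctions_der in_superfunctions_coord simp del: scaleR_minus_left)

context
  fixes l n :: nat
begin

interpretation contact_superalgebra hom "der l 0" "contact_T l" "contact_indices l n"
  "index_parity l" "star l" "omega l"
proof (rule contact_superalgebra.intro)
  have ge: "1 \<le> r" if "r \<in> contact_indices l n" for r
    using that by (simp add: contact_indices_def)
  show "hom (p + q) (a * b)" if "hom p a" "hom q b" for p q a b using that by (rule hom_mult)
  show "hom p (a + b)" if "hom p a" "hom p b" for p a b using that by (rule hom_add)
  show "hom p (c *\<^sub>R a)" if "hom p a" for p c a using that by (rule hom_scaleR)
  show "hom p a \<longleftrightarrow> hom q a" if "p mod 2 = q mod 2" for p q a using that by (rule hom_cong)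
  show "a * b = (-1) ^ (p * q) *\<^sub>R (b * a)" if "hom p a" "hom q b" for p q a b
    using that by (rule supercommute)
  show "linear (der l 0)" by (rule der_linear)
  show "linear (contact_T l r)" for r by (rule contact_T_linear)
  show "hom p (der l 0 a)" if "hom p a" for p a using that by (rule hom_der_0)
  show "der l 0 (a * b) = der l 0 a * b + a * der l 0 b" for a b by (rule der_0_mult)
  show "hom (p + index_parity l r) (contact_T l r a)" if "r \<in> contact_indices l n" "hom p a" for r p a
    using that by (intro contact_T_hom ge)
  show "contact_T l r (a * b) = contact_T l r a * b + (-1) ^ (p * index_parity l r) *\<^sub>R (a * contact_T l r b)"
    if "r \<in> contact_indices l n" "hom p a" for r p a b
    using that by (intro contact_T_mult ge)
  show "der l 0 (contact_T l r a) = contact_T l r (der l 0 a)" if "r \<in> contact_indices l n" for r a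
    using that by (intro der_0_contact_T ge)
  show "contact_T l r (contact_T l s a) =
      (-1) ^ (index_parity l r * index_parity l s) *\<^sub>R contact_T l s (contact_T l r a) +
      (if s = star l r then (- 2 * omega l s) *\<^sub>R der l 0 a else 0)"
    if "r \<in> contact_indices l n" "s \<in> contact_indices l n" for r s a
    using that by (intro contact_T_contact_T ge)
  show "finite (contact_indices l n)" by (simp add: contact_indices_def)
  fix r assume r: "r \<in> contact_indices l n"
  then show "star l r \<in> contact_indices l n" by (rule star_in_indices)
  show "star l (star l r) = r" "index_parity l (star l r) = index_parity l r"
    "omega l (star l r) = - ((-1) ^ index_parity l r) * omega l r" "omega l r * omega l r = 1"
    using ge[OF r] by (simp_all only: star_star parity_star omega_star omega_square)
qed

section \<open>Contact fields as operators on the total type\<close>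

lemma indices_ge_1: "r \<in> contact_indices l n \<Longrightarrow> 1 \<le> r"
  by (simp add: contact_indices_def)

lemma X_zero_left: "X p 0 g = 0"
  by (rule linear_0[OF X_linear_left])

definition contact_op :: "superfun \<Rightarrow> superfun \<Rightarrow> superfun" where
  "contact_op f g = X 0 (part 0 f) g + X 1 (part 1 f) g"

lemma X_mod: "X (p mod 2) f g = X p f g"
proof -
  have "(-1 :: real) ^ (p mod 2 * k) = (-1) ^ (p * k)" for k
    by (simp add: minus_one_power_iff)
  then show ?thesis by (simp add: X_def)
qed

lemma contact_op_hom:
  assumes "hom p f"
  shows "contact_op f g = X p f g"
proof (cases "even p")
  case True
  then have "part 0 f = f" "part 1 f = 0"
    using assms hom_part_eq[of 0 f] hom_cong[of p 0 f] part_hom_other[of p f 1] by auto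
  with True X_mod[of p f g] show ?thesis
    by (simp add: contact_op_def X_zero_left)
next
  case False
  then have "part 1 f = f" "part 0 f = 0"
    using assms hom_part_eq[of 1 f] hom_cong[of p 1 f] part_hom_other[of p f 0]
    by (auto simp: odd_iff_mod_2_eq_one)
  with False X_mod[of p f g] show ?thesis
    by (simp add: contact_op_def X_zero_left odd_iff_mod_2_eq_one)
qed

lemma contact_op_linear: "linear (contact_op f)"
  unfolding contact_op_def by (intro linear_compose_add X_linear)

lemma contact_op_linear_left: "linear (\<lambda>f. contact_op f g)"
  unfolding contact_op_def
  by (intro linear_compose_add linear_compose[OF part_linear X_linear_left, unfolded o_def])

lemma in_superfunctions_X:
  assumes "in_superfunctions l n f" "in_superfunctions l n g"
  shows "in_superfunctions l n (X p f g)"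
  unfolding X_def using assms star_in
  by (intro in_superfunctions_diff in_superfunctions_mult in_superfunctions_scaleR
      in_superfunctions_der in_superfunctions_sum in_superfunctions_contact_T) auto

lemma in_superfunctions_contact_op:
  "in_superfunctions l n f \<Longrightarrow> in_superfunctions l n g \<Longrightarrow> in_superfunctions l n (contact_op f g)"
  unfolding contact_op_def by (intro in_superfunctions_add in_superfunctions_X in_superfunctions_part)

text \<open>The inner sum over \<open>s\<close> collapses to \<open>s = star l r\<close>. The
  membership of \<open>g\<close> matters because the field is set to zero off the carrier, unlike
  \<open>contact_op\<close>.\<close>

lemma contact_field_eq:
  assumes "in_superfunctions l n g"
  shows "contact_field l n (coeffs f) (coeffs g) = coeffs (contact_op f g)"
proof -
  let ?t = "\<lambda>p r. ((-1) ^ (p * index_parity l r) * omega l r) *\<^sub>R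
        (contact_T l r (part p f) * contact_T l (star l r) g)"
  have "(\<Sum>s\<in>contact_indices l n. ((-1) ^ (p * index_parity l r) * omega_inv l r s) \<cdot>
        (T_field l r (parity_part p (coeffs f)) \<odot> T_field l s (coeffs g))) = coeffs (?t p r)"
    if r: "r \<in> contact_indices l n" for p r
  proof -
    have "((-1) ^ (p * index_parity l r) * omega_inv l r s) \<cdot>
        (T_field l r (parity_part p (coeffs f)) \<odot> T_field l s (coeffs g)) =
      (if s = star l r then coeffs (?t p r) else 0)" if "s \<in> contact_indices l n" for s
    proof -
      have T_eq: "T_field l r (parity_part p (coeffs f)) = coeffs (contact_T l r (part p f))"
        using indices_ge_1[OF r] by (simp add: T_field_eq flip: part.rep_eq)
      show ?thesis
        unfolding T_eq using indices_ge_1[OF r] indices_ge_1[OF that]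
        by (auto simp: omega_inv_eq T_field_eq scaleR_superfun.rep_eq times_superfun.rep_eq
            sscale_def fun_eq_iff)
    qed
    then have "(\<Sum>s\<in>contact_indices l n. ((-1) ^ (p * index_parity l r) * omega_inv l r s) \<cdot>
        (T_field l r (parity_part p (coeffs f)) \<odot> T_field l s (coeffs g))) =
      (\<Sum>s\<in>contact_indices l n. if s = star l r then coeffs (?t p r) else 0)"
      by (intro sum.cong refl)
    also have "\<dots> = coeffs (?t p r)"
      using star_in[OF r] finite_R by (subst sum.delta) simp_all
    finally show ?thesis .
  qed
  then have "(\<Sum>r\<in>contact_indices l n. \<Sum>s\<in>contact_indices l n. ((-1) ^ (p * index_parity l r) * omega_inv l r s) \<cdot>
        (T_field l r (parity_part p (coeffs f)) \<odot> T_field l s (coeffs g))) = coeffs (\<Sum>r\<in>contact_indices l n. ?t p r)" for p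
    unfolding coeffs_sum by (intro sum.cong refl)
  then have t: "parity_part p (coeffs f) \<odot> pd l 0 (coeffs g) - (1 / 2) \<cdot>
      (\<Sum>r\<in>contact_indices l n. \<Sum>s\<in>contact_indices l n. ((-1) ^ (p * index_parity l r) * omega_inv l r s) \<cdot>
        (T_field l r (parity_part p (coeffs f)) \<odot> T_field l s (coeffs g))) = coeffs (X p (part p f) g)" for p
    by (simp add: X_def coeffs_minus scaleR_superfun.rep_eq times_superfun.rep_eq part.rep_eq der.rep_eq)
  show ?thesis
    unfolding contact_field_def contact_op_def contact_indices_def[symmetric]
    using assms t[of 0] t[of 1] by (simp add: in_superfunctions_def plus_superfun.rep_eq)
qed

lemma contact_field_outside: "g \<notin> superfunctions l n \<Longrightarrow> contact_field l n f g = 0"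
  by (simp add: contact_field_def)

lemma contact_field_eqI:
  assumes "\<And>g. in_superfunctions l n g \<Longrightarrow> Y (coeffs g) = coeffs (contact_op f g)"
    and "\<And>g. g \<notin> superfunctions l n \<Longrightarrow> Y g = 0"
  shows "Y = contact_field l n (coeffs f)"
proof
  fix g
  show "Y g = contact_field l n (coeffs f) g"
  proof (cases "g \<in> superfunctions l n")
    case True
    then obtain g' where "g = coeffs g'" "in_superfunctions l n g'" by (rule superfunctionsE)
    then show ?thesis by (simp add: assms contact_field_eq)
  qed (simp add: assms contact_field_outside)
qed

lemma contact_field_add:
  "contact_field l n (coeffs f) + contact_field l n (coeffs g) = contact_field l n (coeffs (f + g))"
  by (rule contact_field_eqI)
    (simp_all add: contact_field_eq contact_field_outside linear_add[OF contact_op_linear_left] plus_superfun.rep_eq)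

lemma contact_field_scale:
  "(\<lambda>g. c \<cdot> contact_field l n (coeffs f) g) = contact_field l n (coeffs (c *\<^sub>R f))"
  by (rule contact_field_eqI)
    (simp_all add: contact_field_eq contact_field_outside linear_scale[OF contact_op_linear_left]
      scaleR_superfun.rep_eq, simp add: sscale_def fun_eq_iff)

lemma contact_field_superbracket:
  assumes f: "hom p f" "in_superfunctions l n f" and g: "hom q g" "in_superfunctions l n g"
  shows "superbracket p q (contact_field l n (coeffs f)) (contact_field l n (coeffs g)) =
    contact_field l n (coeffs (bracket p f g))"
proof (rule contact_field_eqI)
  fix h assume h: "in_superfunctions l n h"
  have "contact_op f (contact_op g h) - (-1) ^ (p * q) *\<^sub>R contact_op g (contact_op f h) = contact_op (bracket p f g) h"
    using X_commutator[OF f(1) g(1)] contact_op_hom[OF f(1)] contact_op_hom[OF g(1)] contact_op_hom[OF hom_bracket[OF f(1) g(1)]]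
    by simp
  then show "superbracket p q (contact_field l n (coeffs f)) (contact_field l n (coeffs g)) (coeffs h) =
      coeffs (contact_op (bracket p f g) h)"
    using f g h by (simp add: superbracket_def contact_field_eq in_superfunctions_contact_op
        flip: coeffs_minus scaleR_superfun.rep_eq)
next
  fix h assume h: "h \<notin> superfunctions l n"
  \<comment> \<open>Off the carrier the inner field returns 0, which lies in the carrier, so the
    outer field has to be evaluated there.\<close>
  have 0: "contact_field l n (coeffs u) 0 = 0" for u
    using contact_field_eq[of 0 u] linear_0[OF contact_op_linear, of u] by (simp add: zero_superfun.rep_eq)
  show "superbracket p q (contact_field l n (coeffs f)) (contact_field l n (coeffs g)) h = 0"
    using h by (simp add: superbracket_def contact_field_outside 0 sscale_def fun_eq_iff)
qed

section \<open>Recovering the Hamiltonian and its parity from the field\<close>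

lemma X_coord:
  assumes "A \<in> contact_indices l n"
  shows "X p f (coord l A) =
    (- (1 / 2) * (-1) ^ (p * index_parity l A) * omega l (star l A)) *\<^sub>R contact_T l (star l A) f"
proof -
  have "((-1) ^ (p * index_parity l r) * omega l r) *\<^sub>R (contact_T l r f * contact_T l (star l r) (coord l A)) =
    (if r = star l A then ((-1) ^ (p * index_parity l A) * omega l (star l A)) *\<^sub>R contact_T l (star l A) f else 0)"
    if "r \<in> contact_indices l n" for r
    using that assms star_star[of r] star_star[of A] e_star[of A] indices_ge_1[of r] indices_ge_1[of A] star_ge_1[of r l]
    by (auto simp: contact_T_coord)
  then have "(\<Sum>r\<in>contact_indices l n. ((-1) ^ (p * index_parity l r) * omega l r) *\<^sub>R (contact_T l r f * contact_T l (star l r) (coord l A))) =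
    (\<Sum>r\<in>contact_indices l n. if r = star l A then ((-1) ^ (p * index_parity l A) * omega l (star l A)) *\<^sub>R contact_T l (star l A) f else 0)"
    by (intro sum.cong refl)
  also have "\<dots> = ((-1) ^ (p * index_parity l A) * omega l (star l A)) *\<^sub>R contact_T l (star l A) f"
    using star_in[OF assms] finite_R by simp
  finally show ?thesis
    using indices_ge_1[OF assms] by (simp add: X_def der_coord)
qed

text \<open>In the basis of \<open>\<partial>\<^sub>z\<close> and the \<open>T\<^sub>s\<close>, the
  field has component \<open>f\<close> along \<open>\<partial>\<^sub>z\<close> and component
  \<open>X p f (coord l s)\<close> along \<open>T\<^sub>s\<close>. Evaluated at \<open>z\<close>,
  this expresses \<open>f\<close> through values on coordinates.\<close>

lemma X_coord_0:
  "X p f (coord l 0) = f + (\<Sum>s\<in>contact_indices l n. X p f (coord l s) * contact_coeff l s)"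
proof -
  have "(\<Sum>s\<in>contact_indices l n. X p f (coord l s) * contact_coeff l s) =
    (\<Sum>s\<in>contact_indices l n. - (1 / 2) *\<^sub>R (((-1) ^ (p * index_parity l (star l s)) * omega l (star l s)) *\<^sub>R
       (contact_T l (star l s) f * contact_T l (star l (star l s)) (coord l 0))))"
    by (intro sum.cong refl) (simp add: X_coord e_star star_star contact_T_coord_0[OF indices_ge_1])
  also have "\<dots> = (\<Sum>s\<in>contact_indices l n. - (1 / 2) *\<^sub>R (((-1) ^ (p * index_parity l s) * omega l s) *\<^sub>R
       (contact_T l s f * contact_T l (star l s) (coord l 0))))"
    by (rule sum_star)
  finally show ?thesis
    by (simp add: X_def der_coord scaleR_sum_right sum_negf)
qed

lemma X_faithful:
  assumes "\<And>A. A \<le> 2 * l + n \<Longrightarrow> X p f (coord l A) = 0"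
  shows "f = 0"
proof -
  have "X p f (coord l A) = 0" if "A \<in> contact_indices l n" for A
    using that by (intro assms) (simp add: contact_indices_def)
  then show ?thesis using X_coord_0[of p f] assms[of 0] by simp
qed

text \<open>On a coordinate, the two parity parts of \<open>f\<close> produce values of opposite
  parity that add up to zero; hence each value is zero and each part of \<open>f\<close>
  vanishes.\<close>

lemma contact_op_faithful:
  assumes "\<And>A. A \<le> 2 * l + n \<Longrightarrow> contact_op f (coord l A) = 0"
  shows "f = 0"
proof -
  have "X 0 (part 0 f) (coord l A) = 0 \<and> X 1 (part 1 f) (coord l A) = 0" if A: "A \<le> 2 * l + n" for A
  proof -
    have h: "hom (0 + index_parity l A) (X 0 (part 0 f) (coord l A))"
      "hom (1 + index_parity l A) (X 1 (part 1 f) (coord l A))"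
      by (intro hom_X hom_part coord_hom)+
    have "X 0 (part 0 f) (coord l A) = (-1) *\<^sub>R X 1 (part 1 f) (coord l A)"
      using assms[OF A] by (simp add: contact_op_def eq_neg_iff_add_eq_0)
    with hom_scaleR[OF h(2), of "-1"] have "hom (1 + index_parity l A) (X 0 (part 0 f) (coord l A))"
      by simp
    with h(1) have "X 0 (part 0 f) (coord l A) = 0"
      by (rule hom_both) (simp add: mod_Suc)
    with assms[OF A] show ?thesis by (simp add: contact_op_def)
  qed
  then have "part 0 f = 0" "part 1 f = 0" by (blast intro: X_faithful)+
  then show ?thesis using part_sum[of f] by simp
qed

text \<open>This makes \<open>contact_hamiltonian\<close> an actual inverse. The coordinates used
  for testing are themselves superfunctions, so the fields are not cut off there.\<close>

lemma contact_field_inj: "inj_on (contact_field l n) (superfunctions l n)"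
proof (rule inj_onI)
  fix F G
  assume "F \<in> superfunctions l n" "G \<in> superfunctions l n" and eq: "contact_field l n F = contact_field l n G"
  then obtain f g where fg: "F = coeffs f" "G = coeffs g" by (metis superfunctionsE)
  have "contact_op (f - g) (coord l A) = 0" if "A \<le> 2 * l + n" for A
    using fun_cong[OF eq, of "coeffs (coord l A)"] that
    by (simp add: fg contact_field_eq in_superfunctions_coord coeffs_inject linear_diff[OF contact_op_linear_left])
  then have "f - g = 0" by (rule contact_op_faithful)
  then show "F = G" by (simp add: fg)
qed

lemma has_parity_contact_field:
  assumes "hom p f"
  shows "has_parity l n p (contact_field l n (coeffs f))"
  unfolding has_parity_def
proof (intro allI ballI impI)
  fix q g assume "g \<in> superfunctions l n" "homogeneous q g"
  then obtain g' where "g = coeffs g'" "in_superfunctions l n g'" "hom q g'"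
    by (metis superfunctionsE hom_def)
  then show "homogeneous (p + q) (contact_field l n (coeffs f) g)"
    using assms hom_X[OF assms] by (simp add: contact_field_eq contact_op_hom[OF assms] flip: hom_def)
qed

text \<open>The axioms give parities of fields, while the sign rules need parities of Hamiltonians.
  The part of \<open>f\<close> of the opposite parity \<open>q\<close> takes values on coordinates
  that have both parities, so these vanish and faithfulness applies.\<close>

lemma has_parity_contact_fieldD:
  assumes p: "has_parity l n p (contact_field l n (coeffs f))" and f: "in_superfunctions l n f"
  shows "hom p f"
proof -
  define q where "q = Suc p"
  have "part p f + part q f = f"
    using part_sum[of f] part_mod[of p f] part_mod[of q f]
    by (cases "even p") (auto simp: q_def mod2_eq_if add.commute)
  then have split: "contact_op f g = X p (part p f) g + X q (part q f) g" for g
    using linear_add[OF contact_op_linear_left, of "part p f" "part q f" g] by (simp add: contact_op_hom[OF hom_part])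
  have "X q (part q f) (coord l A) = 0" if A: "A \<le> 2 * l + n" for A
  proof -
    have A': "in_superfunctions l n (coord l A)" using A by (rule in_superfunctions_coord)
    then have "hom (p + index_parity l A) (contact_op f (coord l A))"
      using p coord_hom[of l A] unfolding has_parity_def hom_def in_superfunctions_def
      by (metis A' contact_field_eq)
    moreover have "hom (p + index_parity l A) (X p (part p f) (coord l A))"
      by (intro hom_X hom_part coord_hom)
    ultimately have "hom (p + index_parity l A) (X q (part q f) (coord l A))"
      using hom_minus[of "p + index_parity l A" "contact_op f (coord l A)" "X p (part p f) (coord l A)"]
      by (simp add: split)
    moreover have "hom (q + index_parity l A) (X q (part q f) (coord l A))"
      by (intro hom_X hom_part coord_hom)
    ultimately show ?thesis
      by (rule hom_both) (simp add: q_def mod_Suc)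
  qed
  then have "part q f = 0" by (rule X_faithful)
  with \<open>part p f + part q f = f\<close> show ?thesis using hom_part[of p f] by simp
qed

lemma linear_operator_contact_field:
  assumes "in_superfunctions l n f"
  shows "linear_operator l n (contact_field l n (coeffs f))"
  unfolding linear_operator_def
proof (intro conjI allI ballI impI)
  fix g assume "g \<in> superfunctions l n"
  then obtain g' where g: "g = coeffs g'" "in_superfunctions l n g'" by (rule superfunctionsE)
  show "contact_field l n (coeffs f) g \<in> superfunctions l n"
    using assms g in_superfunctions_contact_op by (simp add: contact_field_eq flip: in_superfunctions_def)
  show "contact_field l n (coeffs f) (c \<cdot> g) = c \<cdot> contact_field l n (coeffs f) g" for c
    using g in_superfunctions_scaleR[of l n g' c]
    by (simp add: contact_field_eq linear_scale[OF contact_op_linear] flip: scaleR_superfun.rep_eq)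
  fix h assume "h \<in> superfunctions l n"
  then obtain h' where h: "h = coeffs h'" "in_superfunctions l n h'" by (rule superfunctionsE)
  show "contact_field l n (coeffs f) (g + h) = contact_field l n (coeffs f) g + contact_field l n (coeffs f) h"
    using g h in_superfunctions_add[of l n g' h']
    by (simp add: contact_field_eq linear_add[OF contact_op_linear] flip: plus_superfun.rep_eq)
qed (rule contact_field_outside)

lemma superderivation_contact_field:
  assumes f: "hom p f" "in_superfunctions l n f"
  shows "superderivation l n p (contact_field l n (coeffs f))"
  unfolding superderivation_def
proof (intro conjI allI ballI impI linear_operator_contact_field has_parity_contact_field f)
  fix q g h assume "g \<in> superfunctions l n" "h \<in> superfunctions l n" "homogeneous q g"
  then obtain g' h' where g: "g = coeffs g'" "in_superfunctions l n g'" "hom q g'"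
    and h: "h = coeffs h'" "in_superfunctions l n h'"
    by (metis superfunctionsE hom_def)
  show "contact_field l n (coeffs f) (g \<odot> h) = contact_field l n (coeffs f) g \<odot> h +
      (-1) ^ (p * q) \<cdot> (g \<odot> contact_field l n (coeffs f) h)"
    using g h in_superfunctions_mult[OF g(2) h(2)]
    by (simp add: contact_field_eq contact_op_hom[OF f(1)] X_mult[OF f(1) g(3)]
        flip: times_superfun.rep_eq plus_superfun.rep_eq scaleR_superfun.rep_eq)
qed

section \<open>The Lie superalgebra of contact fields\<close>

lemma contact_fieldsE:
  assumes "Y \<in> contact_fields l n"
  obtains f where "Y = contact_field l n (coeffs f)" "in_superfunctions l n f"
  using assms unfolding contact_fields_def by (metis imageE superfunctionsE)

lemma contact_fieldsI: "in_superfunctions l n f \<Longrightarrow> contact_field l n (coeffs f) \<in> contact_fields l n"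
  by (simp add: contact_fields_def in_superfunctions_def)

lemma in_superfunctions_bracket:
  "in_superfunctions l n f \<Longrightarrow> in_superfunctions l n g \<Longrightarrow> in_superfunctions l n (bracket p f g)"
  unfolding bracket_def
  by (intro in_superfunctions_diff in_superfunctions_X in_superfunctions_mult in_superfunctions_der)

lemma contact_field_parts:
  "contact_field l n (coeffs f) = contact_field l n (coeffs (part 0 f)) + contact_field l n (coeffs (part 1 f))"
  by (simp add: contact_field_add part_sum[simplified])

lemma lie_subsuperalgebra_contact_fields: "lie_subsuperalgebra l n (contact_fields l n)"
  unfolding lie_subsuperalgebra_def
proof (intro conjI allI ballI impI subsetI)
  have "contact_field l n (coeffs 0) = 0"
    using contact_field_scale[of 0 0] by (simp add: sscale_def fun_eq_iff)
  then show "0 \<in> contact_fields l n"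
    using contact_fieldsI[of 0] by simp
next
  fix Y assume "Y \<in> contact_fields l n"
  then obtain f where f: "Y = contact_field l n (coeffs f)" "in_superfunctions l n f" by (rule contact_fieldsE)
  let ?Y = "\<lambda>p. contact_field l n (coeffs (part p f))"
  have split: "Y = ?Y 0 + ?Y 1" unfolding f(1) by (rule contact_field_parts)
  show "Y \<in> vector_fields l n"
    unfolding vector_fields_def
    using split superderivation_contact_field[OF hom_part in_superfunctions_part[OF f(2)]] by blast
  show "\<exists>Y'\<in>contact_fields l n. \<exists>Z\<in>contact_fields l n. has_parity l n 0 Y' \<and> has_parity l n 1 Z \<and> Y = Y' + Z"
    using split has_parity_contact_field[OF hom_part] contact_fieldsI[OF in_superfunctions_part[OF f(2)]] by blast
  show "(\<lambda>g. c \<cdot> Y g) \<in> contact_fields l n" for c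
    unfolding f(1) contact_field_scale by (intro contact_fieldsI in_superfunctions_scaleR f)
  fix Z assume "Z \<in> contact_fields l n"
  then obtain g where g: "Z = contact_field l n (coeffs g)" "in_superfunctions l n g" by (rule contact_fieldsE)
  show "Y + Z \<in> contact_fields l n"
    unfolding f(1) g(1) contact_field_add by (intro contact_fieldsI in_superfunctions_add f g)
  show "superbracket p q Y Z \<in> contact_fields l n" if "has_parity l n p Y \<and> has_parity l n q Z" for p q
  proof -
    have "hom p f" "hom q g"
      using that f g by (auto intro: has_parity_contact_fieldD)
    then show ?thesis
      using f g by (simp add: contact_field_superbracket contact_fieldsI in_superfunctions_bracket)
  qed
qed

section \<open>The modules of contact densities\<close>

lemma contact_hamiltonian_eq:
  "in_superfunctions l n f \<Longrightarrow> contact_hamiltonian l n (contact_field l n (coeffs f)) = coeffs f"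
  unfolding contact_hamiltonian_def in_superfunctions_def
  by (rule the_inv_into_f_f[OF contact_field_inj])

definition density_op :: "real \<Rightarrow> superfun \<Rightarrow> superfun \<Rightarrow> superfun" where
  "density_op c f g = contact_op f g + c *\<^sub>R (der l 0 f * g)"

lemma density_op_hom: "hom p f \<Longrightarrow> density_op c f g = density c p f g"
  by (simp add: density_op_def density_def contact_op_hom)

lemma density_op_linear: "linear (density_op c f)"
  by (rule linearI) (simp_all add: density_op_def linear_add[OF contact_op_linear] linear_scale[OF contact_op_linear] algebra_simps)

lemma density_op_linear_left: "linear (\<lambda>f. density_op c f g)"
  by (rule linearI) (simp_all add: density_op_def linear_add[OF contact_op_linear_left] linear_scale[OF contact_op_linear_left]
      der_simps algebra_simps)

lemma F_action_eq:
  "in_superfunctions l n f \<Longrightarrow> in_superfunctions l n g \<Longrightarrow>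
    F_action l n c (contact_field l n (coeffs f)) (coeffs g) = coeffs (density_op c f g)"
  by (simp add: F_action_def density_op_def contact_field_eq contact_hamiltonian_eq plus_superfun.rep_eq
      scaleR_superfun.rep_eq times_superfun.rep_eq der.rep_eq)

lemma in_superfunctions_density_op:
  "in_superfunctions l n f \<Longrightarrow> in_superfunctions l n g \<Longrightarrow> in_superfunctions l n (density_op c f g)"
  unfolding density_op_def
  by (intro in_superfunctions_add in_superfunctions_contact_op in_superfunctions_scaleR in_superfunctions_mult
      in_superfunctions_der)

text \<open>Linearity in the field is linearity of \<open>density_op\<close> in the Hamiltonian. The
  bracket axiom is \<open>density_commutator\<close>, once the parities of the Hamiltonians have
  been read off from the fields.\<close>

lemma lie_supermodule_F_action:
  "lie_supermodule l n (contact_fields l n) (superfunctions l n) (F_action l n c)"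
  unfolding lie_supermodule_def
proof (intro conjI allI ballI impI lie_subsuperalgebra_contact_fields)
  show "0 \<in> superfunctions l n"
    using in_superfunctions_zero[of l n] by (simp add: in_superfunctions_def zero_superfun.rep_eq)
next
  fix u v assume "u \<in> superfunctions l n" "v \<in> superfunctions l n"
  then obtain u' v' where u: "u = coeffs u'" "in_superfunctions l n u'"
    and v: "v = coeffs v'" "in_superfunctions l n v'" by (metis superfunctionsE)
  show "u + v \<in> superfunctions l n"
    using u v in_superfunctions_add by (simp flip: plus_superfun.rep_eq in_superfunctions_def)
  fix Y assume "Y \<in> contact_fields l n"
  then obtain f where f: "Y = contact_field l n (coeffs f)" "in_superfunctions l n f" by (rule contact_fieldsE)
  show "F_action l n c Y (u + v) = F_action l n c Y u + F_action l n c Y v"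
    using f u v
    by (simp add: F_action_eq in_superfunctions_add linear_add[OF density_op_linear] flip: plus_superfun.rep_eq)
next
  fix v assume "v \<in> superfunctions l n"
  then obtain v' where v: "v = coeffs v'" "in_superfunctions l n v'" by (rule superfunctionsE)
  show "a \<cdot> v \<in> superfunctions l n" for a
    using v in_superfunctions_scaleR by (simp flip: scaleR_superfun.rep_eq in_superfunctions_def)
  show "v = parity_part 0 v + parity_part 1 v"
    using part_sum[of v'] unfolding v by (metis part.rep_eq plus_superfun.rep_eq)
  show "parity_part p v \<in> superfunctions l n" for p
    using v in_superfunctions_part by (simp flip: part.rep_eq in_superfunctions_def)
  fix Y assume "Y \<in> contact_fields l n"
  then obtain f where f: "Y = contact_field l n (coeffs f)" "in_superfunctions l n f" by (rule contact_fieldsE)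
  show "F_action l n c Y v \<in> superfunctions l n"
    using f v in_superfunctions_density_op by (simp add: F_action_eq flip: in_superfunctions_def)
  show "F_action l n c Y (a \<cdot> v) = a \<cdot> F_action l n c Y v" for a
    using f v by (simp add: F_action_eq in_superfunctions_scaleR linear_scale[OF density_op_linear]
        flip: scaleR_superfun.rep_eq)
  show "F_action l n c (\<lambda>g. a \<cdot> Y g) v = a \<cdot> F_action l n c Y v" for a
    using f v by (simp add: contact_field_scale F_action_eq in_superfunctions_scaleR
        linear_scale[OF density_op_linear_left] flip: scaleR_superfun.rep_eq)
  show "homogeneous (p + q) (F_action l n c Y v)" if "has_parity l n p Y \<and> homogeneous q v" for p q
  proof -
    have "hom p f" using that f by (auto intro: has_parity_contact_fieldD)
    moreover have "hom q v'" using that v by (simp add: hom_def)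
    ultimately have "hom (p + q) (density_op c f v')"
      by (simp add: density_op_hom density_def hom_add hom_scaleR hom_X hom_mult hom_der_0)
    with f v show ?thesis by (simp add: F_action_eq hom_def)
  qed
  fix Z assume "Z \<in> contact_fields l n"
  then obtain g where g: "Z = contact_field l n (coeffs g)" "in_superfunctions l n g" by (rule contact_fieldsE)
  show "F_action l n c (Y + Z) v = F_action l n c Y v + F_action l n c Z v"
    unfolding f(1) g(1) v(1) contact_field_add using f g v
    by (simp add: F_action_eq in_superfunctions_add linear_add[OF density_op_linear_left]
        plus_superfun.rep_eq[of "density_op c f v'"])
  show "F_action l n c (superbracket p q Y Z) v =
      F_action l n c Y (F_action l n c Z v) - (-1) ^ (p * q) \<cdot> F_action l n c Z (F_action l n c Y v)"
    if "has_parity l n p Y \<and> has_parity l n q Z" for p q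
  proof -
    have p: "hom p f" "hom q g" using that f g by (auto intro: has_parity_contact_fieldD)
    have "density_op c f (density_op c g v') - (-1) ^ (p * q) *\<^sub>R density_op c g (density_op c f v') = density_op c (bracket p f g) v'"
      using density_commutator[OF p] by (simp add: density_op_hom[OF p(1)] density_op_hom[OF p(2)] density_op_hom[OF hom_bracket[OF p]])
    then show ?thesis
      using f g v p
      by (simp add: contact_field_superbracket F_action_eq in_superfunctions_bracket in_superfunctions_density_op
          flip: coeffs_minus scaleR_superfun.rep_eq)
  qed
qed

section \<open>The divergence of a contact field\<close>

lemma sum_index_parity: "(\<Sum>r\<in>contact_indices l n. (-1 :: real) ^ index_parity l r) = 2 * real l - real n"
proof -
  have "contact_indices l n = {1..2 * l} \<union> {2 * l + 1..2 * l + n}" by (auto simp: contact_indices_def)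
  then have "(\<Sum>r\<in>contact_indices l n. (-1 :: real) ^ index_parity l r) =
     (\<Sum>r\<in>{1..2 * l}. (-1) ^ index_parity l r) + (\<Sum>r\<in>{2 * l + 1..2 * l + n}. (-1) ^ index_parity l r)"
    by (simp add: sum.union_disjoint)
  also have "(\<Sum>r\<in>{1..2 * l}. (-1 :: real) ^ index_parity l r) = (\<Sum>r\<in>{1..2 * l}. 1)"
    by (intro sum.cong) (auto simp: index_parity_def)
  also have "(\<Sum>r\<in>{2 * l + 1..2 * l + n}. (-1 :: real) ^ index_parity l r) = (\<Sum>r\<in>{2 * l + 1..2 * l + n}. -1)"
    by (intro sum.cong) (auto simp: index_parity_def)
  finally show ?thesis by simp
qed

text \<open>Substituting \<open>X_coord_0\<close> for the component along \<open>z\<close> completes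
  each derivative of another component to a \<open>T\<close>-derivative, so the divergence is
  \<open>f'\<close> plus a signed sum of the \<open>T\<^sub>s\<close> applied to the components
  along them. By \<open>sum_T_T\<close> that sum is half the superdimension \<open>2 * l - n\<close>
  of the contact distribution times \<open>f'\<close>, and \<open>1 + (2 * l - n) / 2\<close> is the
  constant claimed.\<close>

lemma divergence_X:
  assumes f: "hom p f"
  shows "(\<Sum>A\<in>{0..2 * l + n}. (-1) ^ ((p + index_parity l A) * index_parity l A) *\<^sub>R der l A (X p f (coord l A))) =
    ((real_of_int (superdim l n) + 1) / 2) *\<^sub>R der l 0 f"
proof -
  define R where "R = contact_indices l n"
  define a where "a s = X p f (coord l s)" for s
  have a_hom: "hom (p + index_parity l s) (a s)" for s
    unfolding a_def by (intro hom_X f coord_hom)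
  have "{0..2 * l + n} = insert 0 R" "0 \<notin> R" "finite R" by (auto simp: R_def contact_indices_def)
  then have "(\<Sum>A\<in>{0..2 * l + n}. (-1) ^ ((p + index_parity l A) * index_parity l A) *\<^sub>R der l A (X p f (coord l A))) =
    der l 0 (X p f (coord l 0)) + (\<Sum>s\<in>R. (-1) ^ ((p + index_parity l s) * index_parity l s) *\<^sub>R der l s (a s))"
    by (simp add: a_def index_parity_def)
  \<comment> \<open>The coefficients of the \<open>T\<^sub>s\<close> are independent of
    \<open>z\<close>, so only the components are differentiated.\<close>
  also have "der l 0 (X p f (coord l 0)) = der l 0 f + (\<Sum>s\<in>R. der l 0 (a s) * contact_coeff l s)"
    unfolding X_coord_0 der_simps der_0_mult by (simp add: a_def R_def der_0_contact_coeff[OF indices_ge_1])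
  also have "\<dots> + (\<Sum>s\<in>R. (-1) ^ ((p + index_parity l s) * index_parity l s) *\<^sub>R der l s (a s)) =
     der l 0 f + (\<Sum>s\<in>R. (-1) ^ ((p + index_parity l s) * index_parity l s) *\<^sub>R contact_T l s (a s))"
  proof -
    have "der l 0 (a s) * contact_coeff l s =
       (-1) ^ ((p + index_parity l s) * index_parity l s) *\<^sub>R (contact_coeff l s * der l 0 (a s))" if "s \<in> R" for s
      using that by (intro supercommute hom_der_0 a_hom hom_contact_coeff indices_ge_1) (simp add: R_def)
    then show ?thesis
      by (simp add: contact_T_def scaleR_add_right sum.distrib)
  qed
  \<comment> \<open>The sign of the divergence, the sign and the factor \<open>-1/2\<close> in
    \<open>X_coord\<close>, and \<open>omega_star\<close> combine to \<open>omega l s / 2\<close>,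
    free of \<open>p\<close>.\<close>
  also have "(\<Sum>s\<in>R. (-1) ^ ((p + index_parity l s) * index_parity l s) *\<^sub>R contact_T l s (a s)) =
     (\<Sum>s\<in>R. (1 / 2) *\<^sub>R (omega l s *\<^sub>R contact_T l s (contact_T l (star l s) f)))"
  proof (intro sum.cong refl)
    fix s assume "s \<in> R"
    then have s: "s \<in> contact_indices l n" by (simp add: R_def)
    show "(-1) ^ ((p + index_parity l s) * index_parity l s) *\<^sub>R contact_T l s (a s) =
       (1 / 2) *\<^sub>R (omega l s *\<^sub>R contact_T l s (contact_T l (star l s) f))"
      using s \<sigma>_star[OF s]
      by (cases "even p"; cases "even (index_parity l s)")
        (simp_all add: a_def X_coord linear_scale[OF contact_T_linear] linear_neg[OF contact_T_linear])
  qed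
  also have "\<dots> = (1 / 2) *\<^sub>R ((\<Sum>r\<in>R. (-1) ^ index_parity l r) *\<^sub>R der l 0 f)"
    unfolding scaleR_sum_right[symmetric] R_def sum_T_T ..
  also have "der l 0 f + \<dots> = ((real_of_int (superdim l n) + 1) / 2) *\<^sub>R der l 0 f"
  proof -
    have "(real_of_int (superdim l n) + 1) / 2 = 1 + (2 * real l - real n) / 2"
      by (simp add: superdim_def field_simps)
    then show ?thesis
      unfolding R_def sum_index_parity by (simp only: scaleR_left_distrib) simp
  qed
  finally show ?thesis .
qed

lemma part_hom_eq: "hom p f \<Longrightarrow> part q f = (if p mod 2 = q mod 2 then f else 0)"
  by (metis hom_part_eq part_hom_other part_mod)

text \<open>For homogeneous \<open>f\<close> every component is homogeneous, so only one of its two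
  parity summands is nonzero and \<open>divergence_X\<close> applies. Additivity in \<open>f\<close>
  gives the general case.\<close>

lemma divergence_contact_field:
  "divergence l n (contact_field l n (coeffs f)) =
     coeffs (((real_of_int (superdim l n) + 1) / 2) *\<^sub>R der l 0 f)"
proof -
  define D where "D f = (\<Sum>A\<in>{0..2 * l + n}. \<Sum>p\<in>{0, 1}.
     (-1) ^ (p * index_parity l A) *\<^sub>R der l A (part p (contact_op f (coord l A))))" for f
  have D_hom: "D f = ((real_of_int (superdim l n) + 1) / 2) *\<^sub>R der l 0 f" if f: "hom p f" for p f
  proof -
    have "(\<Sum>q\<in>{0, 1}. (-1) ^ (q * index_parity l A) *\<^sub>R der l A (part q (contact_op f (coord l A)))) =
       (-1) ^ ((p + index_parity l A) * index_parity l A) *\<^sub>R der l A (X p f (coord l A))" for A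
    proof -
      define m where "m = p + index_parity l A"
      have h: "hom m (X p f (coord l A))" unfolding m_def by (intro hom_X f coord_hom)
      have "part 0 (X p f (coord l A)) = (if even m then X p f (coord l A) else 0)"
        "part 1 (X p f (coord l A)) = (if even m then 0 else X p f (coord l A))"
        unfolding part_hom_eq[OF h] by (auto simp: even_iff_mod_2_eq_zero odd_iff_mod_2_eq_one)
      then show ?thesis
        unfolding contact_op_hom[OF f] m_def[symmetric]
        by (cases "even m") (simp_all add: linear_0[OF der_linear] minus_one_power_iff)
    qed
    then show ?thesis unfolding D_def using divergence_X[OF f] by simp
  qed
  have D_add: "D (f + g) = D f + D g" for f g
    unfolding D_def
    by (simp add: linear_add[OF contact_op_linear_left] linear_add[OF part_linear] der_simps sum.distrib algebra_simps)
  have "divergence l n (contact_field l n (coeffs f)) = coeffs (D f)"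
    unfolding divergence_def D_def coeffs_sum
    by (intro sum.cong refl) (simp add: in_superfunctions_coord contact_field_eq
        scaleR_superfun.rep_eq der.rep_eq part.rep_eq flip: coord.rep_eq)
  also have "D f = D (part 0 f) + D (part 1 f)"
    unfolding D_add[symmetric] part_sum ..
  also have "\<dots> = ((real_of_int (superdim l n) + 1) / 2) *\<^sub>R der l 0 f"
    unfolding D_hom[OF hom_part] scaleR_add_right[symmetric] der_simps[symmetric] part_sum ..
  finally show ?thesis .
qed

text \<open>The weight is chosen so that its product with the factor \<open>(d + 1) / 2\<close> of
  the divergence is \<open>c\<close>; \<open>d \<noteq> -1\<close> allows the cancellation.\<close>

lemma Ber_action_eq_F_action:
  assumes "superdim l n \<noteq> -1" "Y \<in> contact_fields l n" "v \<in> superfunctions l n"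
  shows "Ber_action l n (2 * c / (real_of_int (superdim l n) + 1)) Y v = F_action l n c Y v"
proof -
  obtain f where f: "Y = contact_field l n (coeffs f)" "in_superfunctions l n f"
    using assms(2) by (rule contact_fieldsE)
  obtain v' where v: "v = coeffs v'" "in_superfunctions l n v'"
    using assms(3) by (rule superfunctionsE)
  have "real_of_int (superdim l n) + 1 \<noteq> 0"
    using assms(1) by (metis add_eq_0_iff2 of_int_1 of_int_eq_iff of_int_minus)
  then have "coeffs (density_op c f v') = coeffs (contact_op f v' + (2 * c / (real_of_int (superdim l n) + 1)) *\<^sub>R
      ((((real_of_int (superdim l n) + 1) / 2) *\<^sub>R der l 0 f) * v'))"
    by (simp add: density_op_def)
  then show ?thesis
    unfolding f(1) v(1) F_action_eq[OF f(2) v(2)] Ber_action_def divergence_contact_field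
      contact_field_eq[OF v(2)]
    by (simp only: plus_superfun.rep_eq scaleR_superfun.rep_eq times_superfun.rep_eq)
qed

end

text \<open>Every axiom evaluates the action only on \<open>A\<close> and \<open>V\<close>, and
  closure keeps all arguments there, including the inner values in the bracket axiom. This
  transports the module structure to the Berezinian side in place of an identity for the divergence
  of a bracket.\<close>

lemma lie_supermodule_cong:
  assumes V: "lie_supermodule l n A V act"
    and eq: "\<And>Y v. Y \<in> A \<Longrightarrow> v \<in> V \<Longrightarrow> act' Y v = act Y v"
  shows "lie_supermodule l n A V act'"
proof -
  have closed: "act Y v \<in> V" "u + v \<in> V" "k \<cdot> v \<in> V" if "Y \<in> A" "u \<in> V" "v \<in> V" for Y k u v
    using V that unfolding lie_supermodule_def by simp_all
  have "lie_subsuperalgebra l n A"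
    using V unfolding lie_supermodule_def by simp
  then have "Y + Z \<in> A" "(\<lambda>g. k \<cdot> Y g) \<in> A"
    "has_parity l n p Y \<and> has_parity l n q Z \<Longrightarrow> superbracket p q Y Z \<in> A"
    if "Y \<in> A" "Z \<in> A" for Y Z k p q
    using that unfolding lie_subsuperalgebra_def by simp_all
  with V closed show ?thesis
    unfolding lie_supermodule_def by (simp add: eq)
qed

theorem proposition3p3:
  fixes l n :: nat and lam :: real and d :: int
  assumes "d = superdim l n" and "d \<noteq> -1"
  shows "lie_supermodule_iso l n (contact_fields l n)
           (superfunctions l n) (F_action l n lam)
           (superfunctions l n) (Ber_action l n (2 * lam / (of_int d + 1)))
           (\<lambda>g. g)"
proof -
  have eq: "Ber_action l n (2 * lam / (of_int d + 1)) X v = F_action l n lam X v"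
    if "X \<in> contact_fields l n" "v \<in> superfunctions l n" for X v
    using that assms Ber_action_eq_F_action by simp
  have "lie_supermodule l n (contact_fields l n) (superfunctions l n)
      (Ber_action l n (2 * lam / (of_int d + 1)))"
    by (rule lie_supermodule_cong[OF lie_supermodule_F_action eq])
  then show ?thesis
    unfolding lie_supermodule_iso_def
    using lie_supermodule_F_action eq by (simp add: bij_betw_def)
qed

end
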